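(* Let $d\ge2$, let $p\in(0,1]$, and let $h$ be the log-correlated Gaussian field on $\mathbb R^d$. Let $\rho$ be an admissible mollifier on $\mathbb R^d$. If there exists $\epsilon_0>0$ such that $$\sup_{a\in B(0,1+\epsilon_0)}\int_{\mathbb R^d}\frac1{|a-y|^p}\,\rho(dy)<\infty,$$ then $\rho$ satisfies Condition $(A_p)$: there is a constant $C$, which may depend on $\rho$, $p$ and $d$, such that $$\mathbb E\big[(h_\epsilon^\rho(z)-h_r^\rho(w))^2\big]\le C\left(\frac{|(z,\epsilon)-(w,r)|}{\epsilon\wedge r}\right)^p$$ for all $z,w\in\mathbb R^d$ and all $\epsilon,r\in(0,1]$ with $\frac12\le\epsilon/r\le2$.
   Context: Let $\mathcal S(\mathbb R^d)$ be the Schwartz space and $\mathcal S_0(\mathbb R^d)=\{f\in\mathcal S(\mathbb R^d):\int f\,dx=0\}$. The log-correlated Gaussian field (LGF) $h$ on $\mathbb R^d$ is the centered Gaussian random tempered distribution modulo additive constants with $$\operatorname{Cov}[(h,f_1),(h,f_2)]=\iint_{\mathbb R^d\times\mathbb R^d}\log\frac1{|x-y|}f_1(x)f_2(y)\,dx\,dy,\qquad f_1,f_2\in\mathcal S_0(\mathbb R^d).$$ The additive constant is fixed by requiring that the average of $h$ over the unit sphere is $0$ (i.e. $h$ is replaced by $h-h_1(0)$, with $h_1(0)$ the average of $h$ over the unit sphere centered at $0$), so that $(h,f)$ is defined for smooth compactly supported $f$ with $\int f=1$. An admissible mollifier is a nonnegative Radon measure $\rho$ on $\mathbb R^d$ such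 that (i) $\operatorname{supp}(\rho)\subseteq\overline{B(0,1)}$; (ii) $\rho(\mathbb R^d)=1$; (iii) $\iint\left|\log\frac1{|x-y|}\right|\rho(dx)\rho(dy)<\infty$. For a nonnegative Radon measure $\mu$ with total mass $1$ and $\iint|\log\frac{1}{|x-y|}|\mu(dx)\mu(dy)<\infty$, the pairing $(h,\mu)$ is the $L^2(\mathbb P)$-limit of $(h,\mu*\psi_n)$, where $\psi_n(x)=n^d\psi(nx)$ and $\psi$ is smooth, nonnegative, symmetric, supported in $B(0,1)$, with integral $1$ (the limit exists and does not depend on $\psi$). For $\epsilon>0$, $z\in\mathbb R^d$, $\rho_{z,\epsilon}$ denotes the pushforward of $\rho$ under $y\mapsto z+\epsilon y$, and the mollified field is $h_\epsilon^\rho(z):=(h,\rho_{z,\epsilon})$. *)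

theory Defs
  imports "HOL-Probability.Probability"
begin

section \<open>Schwartz functions and tempered distributions\<close>

text \<open>Iterated partial derivatives; a multi-index is given by a list of basis vectors.\<close>

primrec partial_derivs :: "'a::euclidean_space list \<Rightarrow> ('a \<Rightarrow> real) \<Rightarrow> 'a \<Rightarrow> real" where
  "partial_derivs [] f = f"
| "partial_derivs (b # bs) f = (\<lambda>x. frechet_derivative (partial_derivs bs f) (at x) b)"

definition smooth :: "('a::euclidean_space \<Rightarrow> real) \<Rightarrow> bool" where
  "smooth f \<longleftrightarrow> (\<forall>bs. set bs \<subseteq> Basis \<longrightarrow> (\<forall>x. partial_derivs bs f differentiable (at x)))"

definition schwartz :: "('a::euclidean_space \<Rightarrow> real) set" where
  "schwartz = {f. smooth f \<and>
     (\<forall>k bs. set bs \<subseteq> Basis \<longrightarrow> bounded (range (\<lambda>x. norm x ^ k * partial_derivs bs f x)))}"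

definition schwartz0 :: "('a::euclidean_space \<Rightarrow> real) set" where
  "schwartz0 = {f \<in> schwartz. (\<integral>x. f x \<partial>lborel) = 0}"

definition schwartz_seminorm ::
    "nat \<Rightarrow> 'a::euclidean_space list \<Rightarrow> ('a \<Rightarrow> real) \<Rightarrow> real" where
  "schwartz_seminorm k bs f = (SUP x. norm x ^ k * \<bar>partial_derivs bs f x\<bar>)"

text \<open>The Schwartz topology is metrizable, so continuity is sequential continuity.\<close>

definition schwartz_tendsto ::
    "(nat \<Rightarrow> 'a::euclidean_space \<Rightarrow> real) \<Rightarrow> ('a \<Rightarrow> real) \<Rightarrow> bool" where
  "schwartz_tendsto F f \<longleftrightarrow>
     (\<forall>k bs. set bs \<subseteq> Basis \<longrightarrow>
        (\<lambda>n. schwartz_seminorm k bs (\<lambda>x. F n x - f x)) \<longlonglongrightarrow> 0)"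

definition tempered_distribution :: "(('a::euclidean_space \<Rightarrow> real) \<Rightarrow> real) \<Rightarrow> bool" where
  "tempered_distribution T \<longleftrightarrow>
     (\<forall>f\<in>schwartz. \<forall>g\<in>schwartz. \<forall>a b. T (\<lambda>x. a * f x + b * g x) = a * T f + b * T g) \<and>
     (\<forall>F f. (\<forall>n. F n \<in> schwartz) \<longrightarrow> f \<in> schwartz \<longrightarrow> schwartz_tendsto F f \<longrightarrow>
        (\<lambda>n. T (F n)) \<longlonglongrightarrow> T f)"

section \<open>Random variables\<close>

definition L2_space :: "'w measure \<Rightarrow> ('w \<Rightarrow> real) set" where
  "L2_space M = {X \<in> borel_measurable M. integrable M (\<lambda>\<omega>. (X \<omega>)\<^sup>2)}"

definition L2_tendsto :: "'w measure \<Rightarrow> (nat \<Rightarrow> 'w \<Rightarrow> real) \<Rightarrow> ('w \<Rightarrow> real) \<Rightarrow> bool" where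
  "L2_tendsto M Y X \<longleftrightarrow> (\<forall>n. Y n \<in> L2_space M) \<and> X \<in> L2_space M \<and>
     (\<lambda>n. \<integral>\<omega>. (Y n \<omega> - X \<omega>)\<^sup>2 \<partial>M) \<longlonglongrightarrow> 0"

text \<open>The first alternative is the degenerate Gaussian law of variance zero.\<close>

definition centered_gaussian :: "'w measure \<Rightarrow> ('w \<Rightarrow> real) \<Rightarrow> bool" where
  "centered_gaussian M X \<longleftrightarrow> X \<in> borel_measurable M \<and>
     ((AE \<omega> in M. X \<omega> = 0) \<or> (\<exists>\<sigma>>0. distributed M lborel X (normal_density 0 \<sigma>)))"

definition covariance :: "'w measure \<Rightarrow> ('w \<Rightarrow> real) \<Rightarrow> ('w \<Rightarrow> real) \<Rightarrow> real" where
  "covariance M X Y =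
     (\<integral>\<omega>. (X \<omega> - (\<integral>\<omega>'. X \<omega>' \<partial>M)) * (Y \<omega> - (\<integral>\<omega>'. Y \<omega>' \<partial>M)) \<partial>M)"

section \<open>Measures and mollifiers\<close>

text \<open>Regularity is automatic for locally finite Borel measures on a Euclidean space.\<close>

definition radon_measure :: "'a::euclidean_space measure \<Rightarrow> bool" where
  "radon_measure \<mu> \<longleftrightarrow> sets \<mu> = sets borel \<and> (\<forall>K. compact K \<longrightarrow> emeasure \<mu> K < \<infinity>)"

definition measure_support :: "'a::euclidean_space measure \<Rightarrow> 'a set" where
  "measure_support \<mu> = {x. \<forall>U. open U \<longrightarrow> x \<in> U \<longrightarrow> emeasure \<mu> U > 0}"

text \<open>The value on the diagonal is set explicitly, because \<open>ln (1 / 0) = 0\<close> in HOL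
  while the kernel must charge atoms with infinite energy.\<close>

definition abs_log_kernel :: "'a::euclidean_space \<Rightarrow> 'a \<Rightarrow> ennreal" where
  "abs_log_kernel x y = (if x = y then \<infinity> else ennreal \<bar>ln (1 / norm (x - y))\<bar>)"

definition admissible_mollifier :: "'a::euclidean_space measure \<Rightarrow> bool" where
  "admissible_mollifier \<rho> \<longleftrightarrow> radon_measure \<rho> \<and>
     measure_support \<rho> \<subseteq> cball 0 1 \<and>
     emeasure \<rho> UNIV = 1 \<and>
     (\<integral>\<^sup>+x. \<integral>\<^sup>+y. abs_log_kernel x y \<partial>\<rho> \<partial>\<rho>) < \<infinity>"

definition bump :: "('a::euclidean_space \<Rightarrow> real) \<Rightarrow> bool" where
  "bump \<psi> \<longleftrightarrow> smooth \<psi> \<and> (\<forall>x. \<psi> x \<ge> 0) \<and> (\<forall>x. \<psi> (- x) = \<psi> x) \<and>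
     closure {x. \<psi> x \<noteq> 0} \<subseteq> ball 0 1 \<and> (\<integral>x. \<psi> x \<partial>lborel) = 1"

definition rescale :: "('a::euclidean_space \<Rightarrow> real) \<Rightarrow> nat \<Rightarrow> 'a \<Rightarrow> real" where
  "rescale \<psi> n x = real n ^ DIM('a) * \<psi> (real n *\<^sub>R x)"

definition convolve ::
    "'a::euclidean_space measure \<Rightarrow> ('a \<Rightarrow> real) \<Rightarrow> 'a \<Rightarrow> real" where
  "convolve \<mu> \<phi> x = (\<integral>y. \<phi> (x - y) \<partial>\<mu>)"

text \<open>The normalized surface measure of the unit sphere, as the image of the uniform
  distribution on the unit ball under radial projection.\<close>

definition unit_sphere_measure :: "'a::euclidean_space measure" where
  "unit_sphere_measure =
     distr (uniform_measure lborel (ball 0 1)) borel (\<lambda>x. x /\<^sub>R norm x)"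

section \<open>The log-correlated Gaussian field\<close>

text \<open>\<open>h \<omega> f\<close> is the pairing of the field at the sample point \<open>\<omega>\<close> with \<open>f\<close>.\<close>

definition random_tempered_distribution ::
    "'w measure \<Rightarrow> ('w \<Rightarrow> ('a::euclidean_space \<Rightarrow> real) \<Rightarrow> real) \<Rightarrow> bool" where
  "random_tempered_distribution M h \<longleftrightarrow>
     (\<forall>\<omega>\<in>space M. tempered_distribution (h \<omega>)) \<and>
     (\<forall>f\<in>schwartz. (\<lambda>\<omega>. h \<omega> f) \<in> borel_measurable M)"

text \<open>A distribution modulo additive constants is given by a representative, whose law is
  constrained only on test functions of integral zero.  Since \<open>h \<omega>\<close> is linear,
  Gaussianity of each single pairing is joint Gaussianity of all of them.\<close>

definition log_correlated_field_mod_const ::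
    "'w measure \<Rightarrow> ('w \<Rightarrow> ('a::euclidean_space \<Rightarrow> real) \<Rightarrow> real) \<Rightarrow> bool" where
  "log_correlated_field_mod_const M h \<longleftrightarrow>
     prob_space M \<and> random_tempered_distribution M h \<and>
     (\<forall>f\<in>schwartz0. centered_gaussian M (\<lambda>\<omega>. h \<omega> f)) \<and>
     (\<forall>f\<in>schwartz0. \<forall>g\<in>schwartz0.
        covariance M (\<lambda>\<omega>. h \<omega> f) (\<lambda>\<omega>. h \<omega> g) =
        (\<integral>(x, y). ln (1 / norm (x - y)) * f x * g y \<partial>(lborel \<Otimes>\<^sub>M lborel)))"

definition has_pairing ::
    "'w measure \<Rightarrow> ('w \<Rightarrow> ('a::euclidean_space \<Rightarrow> real) \<Rightarrow> real) \<Rightarrow> 'a measure \<Rightarrow> ('w \<Rightarrow> real) \<Rightarrow> bool"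
  where
  "has_pairing M h \<mu> X \<longleftrightarrow>
     (\<forall>\<psi>. bump \<psi> \<longrightarrow> L2_tendsto M (\<lambda>n \<omega>. h \<omega> (convolve \<mu> (rescale \<psi> n))) X)"

text \<open>The \<open>L\<^sup>2\<close>-limit is unique up to almost sure equality; a version is chosen.\<close>

definition pairing ::
    "'w measure \<Rightarrow> ('w \<Rightarrow> ('a::euclidean_space \<Rightarrow> real) \<Rightarrow> real) \<Rightarrow> 'a measure \<Rightarrow> 'w \<Rightarrow> real" where
  "pairing M h \<mu> = (SOME X. has_pairing M h \<mu> X)"

text \<open>The additive constant is fixed by a vanishing average over the unit sphere.\<close>

definition log_correlated_field ::
    "'w measure \<Rightarrow> ('w \<Rightarrow> ('a::euclidean_space \<Rightarrow> real) \<Rightarrow> real) \<Rightarrow> bool" where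
  "log_correlated_field M h \<longleftrightarrow>
     log_correlated_field_mod_const M h \<and> has_pairing M h unit_sphere_measure (\<lambda>_. 0)"

definition mollified_field ::
    "'w measure \<Rightarrow> ('w \<Rightarrow> ('a::euclidean_space \<Rightarrow> real) \<Rightarrow> real) \<Rightarrow> 'a measure \<Rightarrow>
     real \<Rightarrow> 'a \<Rightarrow> 'w \<Rightarrow> real" where
  "mollified_field M h \<rho> \<epsilon> z = pairing M h (distr \<rho> borel (\<lambda>y. z + \<epsilon> *\<^sub>R y))"

text \<open>The constant is chosen before the field \<open>h\<close> and the probability space \<open>M\<close> that
  carries it, so it depends only on \<open>\<rho>\<close>, \<open>p\<close> and the dimension.  The argument of type
  \<open>'w itself\<close> only names the type of sample points.\<close>

definition condition_A :: "'w itself \<Rightarrow> real \<Rightarrow> 'a::euclidean_space measure \<Rightarrow> bool" where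
  "condition_A W p \<rho> \<longleftrightarrow>
     (\<exists>C. \<forall>(M :: 'w measure) h. log_correlated_field M h \<longrightarrow>
        (\<forall>z w. \<forall>\<epsilon>\<in>{0<..1}. \<forall>r\<in>{0<..1}. 1 / 2 \<le> \<epsilon> / r \<longrightarrow> \<epsilon> / r \<le> 2 \<longrightarrow>
           (\<integral>\<omega>. (mollified_field M h \<rho> \<epsilon> z \<omega> - mollified_field M h \<rho> r w \<omega>)\<^sup>2 \<partial>M)
           \<le> C * (norm ((z, \<epsilon>) - (w, r)) / min \<epsilon> r) powr p))"

end

theory Submission
  imports Defs
begin

text \<open>
  For probability measures \<open>\<mu>\<close>, \<open>\<nu>\<close> the variance of \<open>(h, \<mu>) - (h, \<nu>)\<close> is
  \<open>I(\<mu>, \<mu>) - I(\<mu>, \<nu>) - I(\<nu>, \<mu>) + I(\<nu>, \<nu>)\<close>, where \<open>I\<close> is the mutual logarithmic energy.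
  The elementary inequality \<open>ln a - ln b \<le> \<bar>a - b\<bar>\<^sup>p b\<^sup>-\<^sup>p / p\<close> turns the uniform bound on the Riesz
  potential \<open>\<integral> \<bar>a - y\<bar>\<^sup>-\<^sup>p \<rho>(dy)\<close> into a Hoelder estimate of \<open>I\<close>: moving the points by at most \<open>d\<close>
  changes \<open>I\<close> by at most a multiple of \<open>d\<^sup>p\<close>.  Applied to mollification this shows that the pairings
  \<open>(h, \<mu> * \<psi>\<^sub>n)\<close> form a Cauchy sequence in mean square; applied to the affine maps
  \<open>y \<mapsto> z + \<epsilon> y\<close> and \<open>y \<mapsto> w + r y\<close> it bounds both \<open>I(\<mu>, \<mu>) - I(\<mu>, \<nu>)\<close> and
  \<open>I(\<nu>, \<nu>) - I(\<nu>, \<mu>)\<close> by the right-hand side of Condition (A).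
\<close>

section \<open>Test functions\<close>

text \<open>The logarithmic inequality is one-sided: its right-hand side contains a negative power
  of \<open>b\<close> alone. A difference of two energies is therefore paid for by the Riesz bound
  attached to the energy with the positive sign, so the two halves of the variance cost the factors
  \<open>\<epsilon> powr (- p)\<close> and \<open>r powr (- p)\<close>, both controlled by the
  smaller scale. The Riesz bound holds for every centre, hence survives the addition of an
  independent displacement with the same constant; this is why smoothing at radius d costs only a
  multiple of d^p. The definition of the field raises two obstacles. Its law is prescribed only on
  test functions of integral zero, while a smoothed probability measure has integral 1; the
  normalization over the unit sphere provides one function of integral 1 with finite second moment,
  and the others are compared with it. Moreover \<open>pairing\<close> is a chosen limit that must
  serve all bump functions at once, so its existence, and that of a bump function, has to be
  proved.\<close>

lemma smooth_coinduct:
  assumes "f \<in> Q"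
    and "\<And>g x. g \<in> Q \<Longrightarrow> g differentiable (at x)"
    and "\<And>g b. g \<in> Q \<Longrightarrow> b \<in> Basis \<Longrightarrow> (\<lambda>x. frechet_derivative g (at x) b) \<in> Q"
  shows "smooth f"
proof -
  \<comment> \<open>\<open>Q\<close> is an invariant: iterated derivatives of \<open>f\<close> never
    leave it, so closure under one derivative is enough and no formula for the iterated ones is
    required.\<close>
  have "set bs \<subseteq> Basis \<Longrightarrow> partial_derivs bs f \<in> Q" for bs
    using assms(1,3) by (induction bs) auto
  then show ?thesis
    using assms(2) by (auto simp: smooth_def)
qed

lemma smooth_differentiable: "smooth f \<Longrightarrow> f differentiable (at x)"
  unfolding smooth_def by (metis partial_derivs.simps(1) set_empty2 empty_subsetI)

lemma smooth_frechet_derivative: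
  assumes "smooth f" "b \<in> Basis"
  shows "smooth (\<lambda>x. frechet_derivative f (at x) b)"
proof -
  \<comment> \<open>\<open>partial_derivs\<close> applies the head of the list last, so the
    derivative taken first is the last entry.\<close>
  have "partial_derivs bs (\<lambda>x. frechet_derivative f (at x) b) = partial_derivs (bs @ [b]) f" for bs
    by (induction bs) auto
  then show ?thesis
    using assms unfolding smooth_def
    by (metis Un_insert_right empty_set insert_subset list.simps(15) set_append sup_bot_right)
qed

text \<open>The radius is a parameter because it becomes the smoothing scale: rescaling divides it,
  and convolution adds it to the radius of the measure.\<close>

definition test_fun :: "real \<Rightarrow> ('a::euclidean_space \<Rightarrow> real) set" where
  "test_fun R = {f. smooth f \<and> (\<forall>x. norm x > R \<longrightarrow> f x = 0)}"

lemma test_fun_mono: "R \<le> R' \<Longrightarrow> test_fun R \<subseteq> test_fun R'"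
  by (auto simp: test_fun_def)

lemma test_fun_differentiable: "f \<in> test_fun R \<Longrightarrow> f differentiable (at x)"
  by (auto simp: test_fun_def intro: smooth_differentiable)

lemma test_fun_frechet_derivative:
  assumes "f \<in> test_fun R" "b \<in> Basis"
  shows "(\<lambda>x. frechet_derivative f (at x) b) \<in> test_fun R"
proof -
  have "frechet_derivative f (at x) b = 0" if "norm x > R" for x
  proof -
    have "open {y::'a. norm y > R}"
      by (intro open_Collect_less continuous_intros)
    have "(f has_derivative (\<lambda>_. 0)) (at x)"
      by (rule has_derivative_transform_within_open[OF has_derivative_const \<open>open _\<close>])
         (use assms that in \<open>auto simp: test_fun_def\<close>)
    then show ?thesis
      by (metis frechet_derivative_at)
  qed
  then show ?thesis
    using assms smooth_frechet_derivative by (auto simp: test_fun_def)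
qed

lemma test_fun_partial_derivs:
  assumes "f \<in> test_fun R" "set bs \<subseteq> Basis"
  shows "partial_derivs bs f \<in> test_fun R"
  using assms(2) by (induction bs) (auto simp: assms(1) test_fun_frechet_derivative)

lemma test_fun_coinduct:
  assumes "f \<in> Q"
    and "\<And>g x. g \<in> Q \<Longrightarrow> g differentiable (at x)"
    and "\<And>g b. g \<in> Q \<Longrightarrow> b \<in> Basis \<Longrightarrow> (\<lambda>x. frechet_derivative g (at x) b) \<in> Q"
    and "\<And>x. norm x > R \<Longrightarrow> f x = 0"
  shows "f \<in> test_fun R"
  using smooth_coinduct[of f Q] assms by (auto simp: test_fun_def)

lemma test_fun_continuous: "f \<in> test_fun R \<Longrightarrow> continuous_on S f"
  by (intro differentiable_imp_continuous_on)
     (auto simp: differentiable_on_def intro!: differentiable_at_withinI test_fun_differentiable)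

lemma test_fun_bounded:
  assumes "f \<in> test_fun R"
  obtains B where "B \<ge> 0" "\<And>x. \<bar>f x\<bar> \<le> B"
proof -
  have "compact (f ` cball 0 R)"
    by (intro compact_continuous_image test_fun_continuous[OF assms]) auto
  then obtain B where B: "\<And>x. norm x \<le> R \<Longrightarrow> \<bar>f x\<bar> \<le> B"
    using compact_imp_bounded[of "f ` cball 0 R"] unfolding bounded_iff by (metis imageI mem_cball_0 real_norm_def)
  have "\<bar>f x\<bar> \<le> max B 0" for x
    using B[of x] assms by (cases "norm x \<le> R") (auto simp: test_fun_def)
  then show ?thesis
    using that[of "max B 0"] by auto
qed

lemma test_fun_subset_schwartz: "test_fun R \<subseteq> schwartz"
proof
  fix f :: "'a \<Rightarrow> real" assume f: "f \<in> test_fun R"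
  have "bounded (range (\<lambda>x. norm x ^ k * partial_derivs bs f x))" if bs: "set bs \<subseteq> Basis" for k bs
  proof -
    have g: "partial_derivs bs f \<in> test_fun R"
      by (rule test_fun_partial_derivs[OF f bs])
    obtain B where B: "B \<ge> 0" "\<And>x. \<bar>partial_derivs bs f x\<bar> \<le> B"
      using test_fun_bounded[OF g] by blast
    have "\<bar>norm x ^ k * partial_derivs bs f x\<bar> \<le> \<bar>R\<bar> ^ k * B" for x
    proof (cases "norm x > R")
      case True
      then show ?thesis using g B by (simp add: test_fun_def)
    next
      case False
      then show ?thesis using B by (auto simp: abs_mult intro!: mult_mono power_mono)
    qed
    then show ?thesis
      by (intro boundedI[of _ "\<bar>R\<bar> ^ k * B"]) auto
  qed
  then show "f \<in> schwartz"
    using f by (auto simp: schwartz_def test_fun_def)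
qed

lemma test_fun_diff:
  assumes "f \<in> test_fun R" "g \<in> test_fun R"
  shows "(\<lambda>x. f x - g x) \<in> test_fun R"
proof (rule test_fun_coinduct[where Q = "{\<lambda>x. f x - g x |f g. f \<in> test_fun R \<and> g \<in> test_fun R}"])
  show "(\<lambda>x. f x - g x) \<in> {\<lambda>x. f x - g x |f g. f \<in> test_fun R \<and> g \<in> test_fun R}"
    using assms by blast
  show "f x - g x = 0" if "R < norm x" for x
    using assms that by (simp add: test_fun_def)
next
  fix k :: "'a \<Rightarrow> real" and x assume "k \<in> {\<lambda>x. f x - g x |f g. f \<in> test_fun R \<and> g \<in> test_fun R}"
  then show "k differentiable (at x)"
    by (auto intro!: differentiable_diff intro: test_fun_differentiable)
next
  fix k :: "'a \<Rightarrow> real" and b :: 'a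
  assume "k \<in> {\<lambda>x. f x - g x |f g. f \<in> test_fun R \<and> g \<in> test_fun R}" and b: "b \<in> Basis"
  then obtain f g where k: "k = (\<lambda>x. f x - g x)" and fg: "f \<in> test_fun R" "g \<in> test_fun R"
    by blast
  have "frechet_derivative k (at x) = (\<lambda>v. frechet_derivative f (at x) v - frechet_derivative g (at x) v)" for x
    unfolding k
    by (rule frechet_derivative_at[symmetric], rule has_derivative_diff)
       (use fg in \<open>auto simp: frechet_derivative_works[symmetric] intro: test_fun_differentiable\<close>)
  then have eq: "(\<lambda>x. frechet_derivative k (at x) b) =
      (\<lambda>x. frechet_derivative f (at x) b - frechet_derivative g (at x) b)"
    by simp
  have "(\<lambda>x. p x - q x) \<in> {\<lambda>x. f x - g x |f g. f \<in> test_fun R \<and> g \<in> test_fun R}"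
    if "p \<in> test_fun R" "q \<in> test_fun R" for p q :: "'a \<Rightarrow> real"
    using that by blast
  from this[OF test_fun_frechet_derivative[OF fg(1) b] test_fun_frechet_derivative[OF fg(2) b]]
  show "(\<lambda>x. frechet_derivative k (at x) b) \<in> {\<lambda>x. f x - g x |f g. f \<in> test_fun R \<and> g \<in> test_fun R}"
    unfolding eq .
qed

lemma test_fun_scale:
  assumes f: "f \<in> test_fun R" and a: "a > 0"
  shows "(\<lambda>x. c * f (a *\<^sub>R x)) \<in> test_fun (R / a)"
\<comment> \<open>The coefficient \<open>c\<close> varies over the invariant set because every
  derivative multiplies it by \<open>a\<close>.\<close>
proof (rule test_fun_coinduct[where Q = "{\<lambda>x. c * f (a *\<^sub>R x) |f c. f \<in> test_fun R}"])
  show "(\<lambda>x. c * f (a *\<^sub>R x)) \<in> {\<lambda>x. c * f (a *\<^sub>R x) |f c. f \<in> test_fun R}"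
    using f by blast
  show "c * f (a *\<^sub>R x) = 0" if "R / a < norm x" for x
    using f a that by (simp add: test_fun_def field_simps)
next
  fix k :: "'a \<Rightarrow> real" and x assume "k \<in> {\<lambda>x. c * f (a *\<^sub>R x) |f c. f \<in> test_fun R}"
  then obtain f c where k: "k = (\<lambda>x. c * f (a *\<^sub>R x))" and f: "f \<in> test_fun R"
    by blast
  have D: "(f has_derivative frechet_derivative f (at (a *\<^sub>R x))) (at (a *\<^sub>R x))" for x
    using test_fun_differentiable[OF f] by (simp add: frechet_derivative_works[symmetric])
  have *: "(k has_derivative (\<lambda>v. c * frechet_derivative f (at (a *\<^sub>R x)) (a *\<^sub>R v))) (at x)" for x
    unfolding k by (rule has_derivative_mult_right, rule has_derivative_compose[where f = "\<lambda>x. a *\<^sub>R x"])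
      (auto intro!: derivative_eq_intros D)
  show "k differentiable (at x)"
    using * by (auto simp: differentiable_def)
  fix b :: 'a assume b: "b \<in> Basis"
  have "frechet_derivative k (at x) b = (c * a) * frechet_derivative f (at (a *\<^sub>R x)) b" for x
    using linear_frechet_derivative[OF test_fun_differentiable[OF f, of "a *\<^sub>R x"]] 
    by (simp add: frechet_derivative_at[OF *, symmetric] linear_cmul)
  then show "(\<lambda>x. frechet_derivative k (at x) b) \<in> {\<lambda>x. c * f (a *\<^sub>R x) |f c. f \<in> test_fun R}"
    using test_fun_frechet_derivative[OF f b] by force
qed

lemma frechet_derivative_euclidean:
  fixes f :: "'a::euclidean_space \<Rightarrow> real"
  assumes "f differentiable (at x)"
  shows "frechet_derivative f (at x) v = (\<Sum>b\<in>Basis. (v \<bullet> b) * frechet_derivative f (at x) b)"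
proof -
  have "frechet_derivative f (at x) v = frechet_derivative f (at x) (\<Sum>b\<in>Basis. (v \<bullet> b) *\<^sub>R b)"
    by (simp add: euclidean_representation)
  also have "\<dots> = (\<Sum>b\<in>Basis. (v \<bullet> b) * frechet_derivative f (at x) b)"
    using linear_frechet_derivative[OF assms] by (simp add: linear_sum linear_cmul)
  finally show ?thesis .
qed

lemma test_fun_lipschitz:
  assumes f: "f \<in> test_fun R"
  obtains L where "L \<ge> 0" "\<And>x y. \<bar>f x - f y\<bar> \<le> L * norm (x - y)"
proof -
  have "\<exists>B. B \<ge> 0 \<and> (\<forall>x. \<bar>frechet_derivative f (at x) b\<bar> \<le> B)" if "b \<in> Basis" for b
    using test_fun_bounded[OF test_fun_frechet_derivative[OF f that]] by metis
  then obtain B where B: "\<And>b. b \<in> Basis \<Longrightarrow> B b \<ge> 0"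
      "\<And>b x. b \<in> Basis \<Longrightarrow> \<bar>frechet_derivative f (at x) b\<bar> \<le> B b"
    by metis
  define L where "L = sum B Basis"
  have "L \<ge> 0"
    unfolding L_def using B by (intro sum_nonneg) auto
  have bd: "onorm (frechet_derivative f (at x)) \<le> L" for x
  proof (rule onorm_le)
    fix v
    have "\<bar>\<Sum>b\<in>Basis. (v \<bullet> b) * frechet_derivative f (at x) b\<bar>
        \<le> (\<Sum>b\<in>Basis. \<bar>v \<bullet> b\<bar> * \<bar>frechet_derivative f (at x) b\<bar>)"
      by (rule order_trans[OF sum_abs]) (simp add: abs_mult)
    also have "\<dots> \<le> (\<Sum>b\<in>Basis. norm v * B b)"
      using B by (intro sum_mono mult_mono) (auto simp: Basis_le_norm)
    finally show "norm (frechet_derivative f (at x) v) \<le> L * norm v"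
      by (subst frechet_derivative_euclidean[OF test_fun_differentiable[OF f]])
         (simp add: L_def sum_distrib_left sum_distrib_right mult.commute)
  qed
  have "norm (f x - f y) \<le> L * norm (x - y)" for x y
  proof (rule differentiable_bound[of UNIV])
    show "(f has_derivative frechet_derivative f (at z)) (at z within UNIV)" for z
      using test_fun_differentiable[OF f, of z] by (simp add: frechet_derivative_works[symmetric])
  qed (use bd in auto)
  then show ?thesis
    using that[OF \<open>L \<ge> 0\<close>] by simp
qed

text \<open>The derivative is itself Lipschitz, so the mean value inequality leaves a quadratic
  remainder. That one constant serves all base points is what permits differentiation under the
  integral in \<open>test_fun_convolve\<close>.\<close>

lemma test_fun_linearization:
  assumes f: "f \<in> test_fun R"
  obtains L where "L \<ge> 0"
    "\<And>x v. \<bar>f (x + v) - f x - frechet_derivative f (at x) v\<bar> \<le> L * (norm v)\<^sup>2"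
proof -
  let ?D = "\<lambda>x. frechet_derivative f (at x)"
  have "\<exists>L. L \<ge> 0 \<and> (\<forall>x y. \<bar>?D x b - ?D y b\<bar> \<le> L * norm (x - y))" if "b \<in> Basis" for b
    using test_fun_lipschitz[OF test_fun_frechet_derivative[OF f that]] by metis
  then obtain B where B: "\<And>b. b \<in> Basis \<Longrightarrow> B b \<ge> 0"
      "\<And>b x y. b \<in> Basis \<Longrightarrow> \<bar>?D x b - ?D y b\<bar> \<le> B b * norm (x - y)"
    by metis
  define L where "L = sum B Basis"
  have "L \<ge> 0"
    unfolding L_def using B by (intro sum_nonneg) auto
  have bd: "onorm (\<lambda>v. ?D x v - ?D y v) \<le> L * norm (x - y)" for x y
  proof (rule onorm_le)
    fix v
    have "\<bar>\<Sum>b\<in>Basis. (v \<bullet> b) * (?D x b - ?D y b)\<bar>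
        \<le> (\<Sum>b\<in>Basis. \<bar>v \<bullet> b\<bar> * \<bar>?D x b - ?D y b\<bar>)"
      by (rule order_trans[OF sum_abs]) (simp add: abs_mult)
    also have "\<dots> \<le> (\<Sum>b\<in>Basis. norm v * (B b * norm (x - y)))"
      using B by (intro sum_mono mult_mono) (auto simp: Basis_le_norm)
    also have "\<dots> = L * norm (x - y) * norm v"
      by (simp add: L_def sum_distrib_left sum_distrib_right mult_ac)
    finally show "norm (?D x v - ?D y v) \<le> L * norm (x - y) * norm v"
      by (subst (1 2) frechet_derivative_euclidean[OF test_fun_differentiable[OF f]])
         (simp add: sum_subtractf[symmetric] algebra_simps)
  qed
  have "norm (f (x + v) - f x - ?D x (x + v - x)) \<le> norm (x + v - x) * (L * norm v)" for x v
  proof (rule differentiable_bound_linearization[where S = "cball x (norm v)"])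
    show "x + t *\<^sub>R (x + v - x) \<in> cball x (norm v)" if "t \<in> {0..1}" for t
      using that by (auto simp: dist_norm mult_left_le_one_le)
    show "(f has_derivative ?D z) (at z within cball x (norm v))" for z
      using test_fun_differentiable[OF f, of z]
      by (simp add: frechet_derivative_works[symmetric] has_derivative_at_withinI)
    show "onorm (?D z - ?D x) \<le> L * norm v" if "z \<in> cball x (norm v)" for z
    proof -
      have "L * norm (z - x) \<le> L * norm v"
        using that \<open>L \<ge> 0\<close> by (intro mult_left_mono) (auto simp: dist_norm norm_minus_commute)
      then show ?thesis
        using bd[of z x] by (simp add: fun_diff_def)
    qed
  qed auto
  then show ?thesis
    using that[OF \<open>L \<ge> 0\<close>] by (simp add: power2_eq_square algebra_simps)
qed

section \<open>Smoothing by convolution and the existence of bump functions\<close>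

text \<open>A uniform quadratic remainder integrates against a probability measure to the same
  bound, so the derivative of a convolution is the convolution with the derivative. This closes the
  set of convolutions of test functions under partial differentiation.\<close>

lemma test_fun_convolve:
  fixes \<mu> :: "'a::euclidean_space measure"
  assumes "prob_space \<mu>" and sets: "sets \<mu> = sets borel"
    and supp: "AE y in \<mu>. norm y \<le> R'" and f: "f \<in> test_fun R"
  shows "convolve \<mu> f \<in> test_fun (R + R')"
proof (rule test_fun_coinduct[where Q = "convolve \<mu> ` test_fun R"])
  interpret prob_space \<mu> by fact
  show "convolve \<mu> f \<in> convolve \<mu> ` test_fun R"
    using f by blast
  show "convolve \<mu> f x = 0" if "R + R' < norm x" for x
  proof -
    have "AE y in \<mu>. f (x - y) = 0"
      using supp
    proof eventually_elim
      case (elim y)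
      then have "norm (x - y) > R"
        using that norm_triangle_ineq2[of x y] by linarith
      then show ?case using f by (simp add: test_fun_def)
    qed
    then show ?thesis
      unfolding convolve_def by (rule integral_eq_zero_AE)
  qed
  have int: "integrable \<mu> (\<lambda>y. g (x - y))" if g: "g \<in> test_fun R" for g and x
  proof -
    obtain B where "\<And>x. \<bar>g x\<bar> \<le> B"
      using test_fun_bounded[OF g] by blast
    moreover have "g \<in> borel_measurable borel"
      by (intro borel_measurable_continuous_onI test_fun_continuous[OF g])
    then have "(\<lambda>y. g (x - y)) \<in> borel_measurable \<mu>"
      unfolding measurable_cong_sets[OF sets refl] by measurable
    ultimately show ?thesis
      by (intro integrable_const_bound[where B = B]) auto
  qed
  fix k assume "k \<in> convolve \<mu> ` test_fun R"
  then obtain g where k: "k = convolve \<mu> g" and g: "g \<in> test_fun R" by blast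
  let ?D = "\<lambda>x. frechet_derivative g (at x)"
  \<comment> \<open>Writing the candidate derivative in coordinates makes its linearity immediate;
    its integral form is derived below.\<close>
  define D' where "D' = (\<lambda>x v. \<Sum>b\<in>Basis. (v \<bullet> b) * convolve \<mu> (\<lambda>x. ?D x b) x)"
  obtain L where L: "L \<ge> 0" "\<And>x v. \<bar>g (x + v) - g x - ?D x v\<bar> \<le> L * (norm v)\<^sup>2"
    using test_fun_linearization[OF g] by blast
  have intD: "integrable \<mu> (\<lambda>y. ?D (x - y) b)" if "b \<in> Basis" for x b
    using int[OF test_fun_frechet_derivative[OF g that]] .
  have Deq: "?D x v = (\<Sum>b\<in>Basis. (v \<bullet> b) * ?D x b)" for x v
    by (rule frechet_derivative_euclidean[OF test_fun_differentiable[OF g]])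
  have intDv: "integrable \<mu> (\<lambda>y. ?D (x - y) v)" for x v
    by (subst Deq) (intro Bochner_Integration.integrable_sum integrable_mult_right intD)
  have D': "D' x v = (\<integral>y. ?D (x - y) v \<partial>\<mu>)" for x v
    unfolding D'_def convolve_def by (subst (2) Deq) (simp add: integral_sum intD)
  have est: "\<bar>k (x + v) - k x - D' x v\<bar> \<le> L * (norm v)\<^sup>2" for x v
  proof -
    let ?r = "\<lambda>y. g ((x - y) + v) - g (x - y) - ?D (x - y) v"
    have i: "integrable \<mu> (\<lambda>y. g ((x - y) + v))"
      using int[OF g, of "x + v"] by (simp add: algebra_simps)
    note i' = Bochner_Integration.integrable_diff[OF Bochner_Integration.integrable_diff[OF i int[OF g, of x]] intDv[of x v]]
    have "k (x + v) - k x - D' x v = (\<integral>y. ?r y \<partial>\<mu>)"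
      using i int[OF g, of x] intDv[of x v] by (simp add: k convolve_def D' algebra_simps)
    moreover have "\<bar>\<integral>y. ?r y \<partial>\<mu>\<bar> \<le> (\<integral>y. \<bar>?r y\<bar> \<partial>\<mu>)"
      by (rule integral_abs_bound)
    moreover have "(\<integral>y. \<bar>?r y\<bar> \<partial>\<mu>) \<le> (\<integral>y. L * (norm v)\<^sup>2 \<partial>\<mu>)"
      by (rule integral_mono[OF integrable_abs[OF i'] integrable_const L(2)])
    ultimately show ?thesis
      unfolding lebesgue_integral_const prob_space scaleR_one by linarith
  qed
  have der: "(k has_derivative D' x) (at x)" for x
  proof (rule has_derivativeI_sandwich[of 1])
    show "bounded_linear (D' x)"
      unfolding D'_def by (intro bounded_linear_sum bounded_linear_mult_const bounded_linear_inner_left)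
    show "norm (k y - k x - D' x (y - x)) / norm (y - x) \<le> L * norm (y - x)" if "y \<noteq> x" for y
      using est[of x "y - x"] that by (simp add: divide_le_eq power2_eq_square mult.assoc)
    show "((\<lambda>y. L * norm (y - x)) \<longlongrightarrow> 0) (at x)"
      by (auto intro!: tendsto_eq_intros)
  qed auto
  show "k differentiable (at x)" for x
    using der by (auto simp: differentiable_def)
  show "(\<lambda>x. frechet_derivative k (at x) b) \<in> convolve \<mu> ` test_fun R" if b: "b \<in> Basis" for b
  proof -
    have "frechet_derivative k (at x) b = convolve \<mu> (\<lambda>x. ?D x b) x" for x
      using b by (simp add: frechet_derivative_at[OF der, symmetric] D'_def inner_Basis
          if_distrib[of "\<lambda>x. x * _"] sum.delta cong: if_cong)
    then show ?thesis
      using test_fun_frechet_derivative[OF g b] by auto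
  qed
qed

section \<open>Construction of a bump function\<close>

definition flat_fun :: "nat \<Rightarrow> real \<Rightarrow> real" where
  "flat_fun k t = (if t > 0 then exp (- (1 / t)) / t ^ k else 0)"

text \<open>Admitting the denominators \<open>t ^ k\<close> closes the linear span of the family
  under differentiation, starting from the classical exp(-1/t) at \<open>k = 0\<close>. The delicate
  point is \<open>t = 0\<close>: with u = 1/t the right difference quotient is u^(k+1) / exp u,
  which vanishes as u grows.\<close>

lemma flat_fun_has_derivative:
  "(flat_fun k has_real_derivative flat_fun (k + 2) t - real k * flat_fun (k + 1) t) (at t)"
proof (cases t "0::real" rule: linorder_cases)
  case less
  have "((\<lambda>_. 0) has_real_derivative 0) (at t)"
    by simp
  then have "(flat_fun k has_real_derivative 0) (at t)"
    by (rule has_field_derivative_transform_within_open[of _ _ _ "{..<0}"])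
       (use less in \<open>auto simp: flat_fun_def\<close>)
  then show ?thesis
    using less by (simp add: flat_fun_def)
next
  case equal
  have "((\<lambda>t::real. exp (- (1 / t)) / t ^ k / t) \<longlongrightarrow> 0) (at_right 0)"
  proof -
    have "((\<lambda>x::real. x ^ (k + 1) / exp x) \<longlongrightarrow> 0) at_top"
      by (rule tendsto_power_div_exp_0)
    then have "((\<lambda>t::real. (inverse t) ^ (k + 1) / exp (inverse t)) \<longlongrightarrow> 0) (at_right 0)"
      by (rule filterlim_compose[OF _ filterlim_inverse_at_top_right])
    then show ?thesis
      by (simp add: exp_minus field_simps)
  qed
  then have "((\<lambda>t. flat_fun k t / t) \<longlongrightarrow> 0) (at_right 0)"
    by (rule tendsto_cong[THEN iffD1, rotated])
       (auto simp: flat_fun_def eventually_at_right_field intro!: exI[of _ 1])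
  moreover have "((\<lambda>t. flat_fun k t / t) \<longlongrightarrow> 0) (at_left 0)"
    by (rule tendsto_cong[THEN iffD1, OF _ tendsto_const])
       (auto simp: flat_fun_def eventually_at_left_field intro!: exI[of _ "-1"])
  ultimately have "((\<lambda>t. flat_fun k t / t) \<longlongrightarrow> 0) (at 0)"
    by (rule filterlim_split_at[rotated])
  then show ?thesis
    using equal by (simp add: DERIV_def flat_fun_def)
next
  case greater
  let ?u = "1 / t"
  have u: "((\<lambda>t. 1 / t) has_real_derivative - (?u ^ 2)) (at t)"
    using greater by (auto intro!: derivative_eq_intros simp: power2_eq_square)
  have "((\<lambda>t. exp (- (1 / t)) * (1 / t) ^ k) has_real_derivative
      exp (- ?u) * (real k * ?u ^ (k - 1) * - (?u ^ 2)) + exp (- ?u) * ?u ^ 2 * ?u ^ k) (at t)"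
    using DERIV_mult[OF DERIV_chain2[OF DERIV_exp DERIV_minus[OF u]] DERIV_chain2[OF DERIV_pow u, of k]]
    by (simp add: mult_ac)
  \<comment> \<open>For \<open>k = 0\<close> the truncated exponent \<open>k - 1\<close> does no
    harm, since its coefficient \<open>real k\<close> is 0.\<close>
  moreover have "exp (- ?u) * (real k * ?u ^ (k - 1) * - (?u ^ 2)) + exp (- ?u) * ?u ^ 2 * ?u ^ k
      = exp (- ?u) / t ^ (k + 2) - real k * (exp (- ?u) / t ^ (k + 1))"
    by (cases k) (simp_all add: power2_eq_square divide_inverse power_inverse algebra_simps)
  moreover have "(\<lambda>t. exp (- (1 / t)) * (1 / t) ^ k) = (\<lambda>t::real. exp (- (1 / t)) / t ^ k)"
    by (simp add: power_one_over)
  ultimately have "((\<lambda>t. exp (- (1 / t)) / t ^ k) has_real_derivative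
      exp (- (1 / t)) / t ^ (k + 2) - real k * (exp (- (1 / t)) / t ^ (k + 1))) (at t)"
    by (simp only:)
  then have "((\<lambda>t. exp (- (1 / t)) / t ^ k) has_real_derivative
      flat_fun (k + 2) t - real k * flat_fun (k + 1) t) (at t)"
    using greater by (simp add: flat_fun_def)
  then show ?thesis
    by (rule has_field_derivative_transform_within_open[of _ _ _ "{0<..}"])
       (use greater in \<open>auto simp: flat_fun_def\<close>)
qed

text \<open>Closed under partial differentiation, so that all of its members are smooth.\<close>

inductive_set bump_algebra :: "('a::euclidean_space \<Rightarrow> real) set" where
  coordinate: "(\<lambda>x. x \<bullet> b) \<in> bump_algebra"
| const: "(\<lambda>x. c) \<in> bump_algebra"
| flat: "(\<lambda>x. flat_fun k (1 / 4 - x \<bullet> x)) \<in> bump_algebra"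
| add: "f \<in> bump_algebra \<Longrightarrow> g \<in> bump_algebra \<Longrightarrow> (\<lambda>x. f x + g x) \<in> bump_algebra"
| mult: "f \<in> bump_algebra \<Longrightarrow> g \<in> bump_algebra \<Longrightarrow> (\<lambda>x. f x * g x) \<in> bump_algebra"

text \<open>The chain rule turns the flat generator with exponent \<open>k\<close> into those with
  exponents \<open>k + 1\<close> and \<open>k + 2\<close>, times a linear form. This dictates the
  generators: all exponents, all linear forms and the constants.\<close>

lemma bump_algebra_has_derivative:
  assumes "f \<in> bump_algebra"
  shows "\<exists>D. (\<forall>x. (f has_derivative D x) (at x)) \<and> (\<forall>v. (\<lambda>x. D x v) \<in> bump_algebra)"
  using assms
proof induction
  case (coordinate b)
  show ?case
    by (rule exI[of _ "\<lambda>x v. v \<bullet> b"]) (auto intro: bump_algebra.intros has_derivative_inner_left)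
next
  case (const c)
  show ?case
    by (rule exI[of _ "\<lambda>x v. 0"]) (auto intro: bump_algebra.intros)
next
  case (flat k)
  let ?s = "\<lambda>x. 1 / 4 - x \<bullet> x"
  let ?D = "\<lambda>x v. (flat_fun (k + 2) (?s x) + (- real k) * flat_fun (k + 1) (?s x)) * ((- 2) * (x \<bullet> v))"
  have "((\<lambda>x. flat_fun k (?s x)) has_derivative ?D x) (at x)" for x :: 'a
  proof -
    have "(?s has_derivative (\<lambda>v. (- 2) * (x \<bullet> v))) (at x)"
      by (auto intro!: derivative_eq_intros simp: inner_commute)
    from has_derivative_compose[OF this flat_fun_has_derivative[unfolded has_field_derivative_def], of k]
    show ?thesis
      by simp
  qed
  moreover have "(\<lambda>x. ?D x v) \<in> bump_algebra" for v
    by (intro bump_algebra.intros)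
  ultimately show ?case by (intro exI[of _ ?D]) auto
next
  case (add f g)
  then obtain Df Dg where "\<forall>x. (f has_derivative Df x) (at x)" "\<forall>v. (\<lambda>x. Df x v) \<in> bump_algebra"
      "\<forall>x. (g has_derivative Dg x) (at x)" "\<forall>v. (\<lambda>x. Dg x v) \<in> bump_algebra"
    by blast
  then show ?case
    by (intro exI[of _ "\<lambda>x v. Df x v + Dg x v"]) (auto intro: has_derivative_add bump_algebra.add)
next
  case (mult f g)
  then obtain Df Dg where "\<forall>x. (f has_derivative Df x) (at x)" "\<forall>v. (\<lambda>x. Df x v) \<in> bump_algebra"
      "\<forall>x. (g has_derivative Dg x) (at x)" "\<forall>v. (\<lambda>x. Dg x v) \<in> bump_algebra"
    by blast
  with mult.hyps show ?case
    by (intro exI[of _ "\<lambda>x v. f x * Dg x v + Df x v * g x"])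
       (auto intro!: has_derivative_mult bump_algebra.add bump_algebra.mult)
qed

lemma bump_algebra_smooth: "f \<in> bump_algebra \<Longrightarrow> smooth f"
proof (erule smooth_coinduct)
  fix g :: "'a \<Rightarrow> real" and x b
  assume "g \<in> bump_algebra"
  then obtain D where D: "\<And>x. (g has_derivative D x) (at x)" "\<And>v. (\<lambda>x. D x v) \<in> bump_algebra"
    using bump_algebra_has_derivative by blast
  from D show "g differentiable (at x)"
    by (auto simp: differentiable_def)
  from D show "(\<lambda>x. frechet_derivative g (at x) b) \<in> bump_algebra"
    by (simp add: frechet_derivative_at[OF D(1), symmetric])
qed

lemma test_fun_integrable: "f \<in> test_fun R \<Longrightarrow> integrable lborel f"
proof -
  assume f: "f \<in> test_fun R"
  have "integrable lborel (\<lambda>x. indicator (cball 0 R) x *\<^sub>R f x)"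
    by (rule borel_integrable_compact) (auto intro: test_fun_continuous[OF f])
  moreover have "(\<lambda>x. indicator (cball 0 R) x *\<^sub>R f x) = f"
    using f by (auto simp: fun_eq_iff indicator_def test_fun_def)
  ultimately show ?thesis by simp
qed

text \<open>\<open>has_pairing\<close> quantifies over all bump functions, so it identifies a limit
  only once there is at least one.\<close>

lemma bump_exists: "\<exists>\<psi> :: 'a::euclidean_space \<Rightarrow> real. bump \<psi>"
proof -
  \<comment> \<open>Radius 1/2 leaves a margin: \<open>bump\<close> wants the closure of the
    nonvanishing set inside the open unit ball.\<close>
  define E :: "'a \<Rightarrow> real" where "E = (\<lambda>x. flat_fun 0 (1 / 4 - x \<bullet> x))"
  have E_alg: "E \<in> bump_algebra"
    unfolding E_def by (rule bump_algebra.flat)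
  have E_pos: "E x \<ge> 0" for x
    by (simp add: E_def flat_fun_def)
  have E_supp: "E x = 0 \<longleftrightarrow> norm x \<ge> 1 / 2" for x
  proof -
    have "E x = 0 \<longleftrightarrow> (norm x)\<^sup>2 \<ge> (1 / 2)\<^sup>2"
      by (auto simp: E_def flat_fun_def power2_norm_eq_inner power_one_over)
    also have "\<dots> \<longleftrightarrow> norm x \<ge> 1 / 2"
      by (subst abs_le_square_iff[symmetric]) simp
    finally show ?thesis .
  qed
  have E_test: "E \<in> test_fun (1 / 2)"
    using bump_algebra_smooth[OF E_alg] by (auto simp: test_fun_def E_supp)
  have "integral\<^sup>L lborel E \<noteq> 0"
  proof
    assume "integral\<^sup>L lborel E = 0"
    then have "AE x in lborel. E x = 0"
      using integral_nonneg_eq_0_iff_AE[OF test_fun_integrable[OF E_test]] E_pos by simp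
    then have "AE x in lborel. x \<notin> ball (0::'a) (1 / 2)"
      by (simp add: E_supp not_less)
    then have "emeasure lborel (ball (0::'a) (1 / 2)) = 0"
      using AE_iff_null_sets[of "ball (0::'a) (1 / 2)" lborel] by (simp add: null_sets_def)
    moreover have "emeasure lborel (ball (0::'a) (1 / 2)) \<noteq> 0"
      using content_ball_pos[of "1 / 2" "0::'a"] by (auto simp: measure_def)
    ultimately show False by simp
  qed
  moreover have "integral\<^sup>L lborel E \<ge> 0"
    using E_pos by simp
  ultimately have I: "integral\<^sup>L lborel E > 0" by simp
  define \<psi> where "\<psi> = (\<lambda>x. (1 / integral\<^sup>L lborel E) * E x)"
  have "smooth \<psi>"
    unfolding \<psi>_def by (intro bump_algebra_smooth bump_algebra.mult bump_algebra.const E_alg)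
  moreover have "closure {x. \<psi> x \<noteq> 0} \<subseteq> ball 0 1"
  proof -
    have "closure {x. \<psi> x \<noteq> 0} \<subseteq> cball 0 (1 / 2)"
      using I by (intro closure_minimal) (auto simp: \<psi>_def E_supp)
    then show ?thesis by auto
  qed
  moreover have "\<psi> (- x) = \<psi> x" for x
    by (simp add: \<psi>_def E_def)
  moreover have "(\<integral>x. \<psi> x \<partial>lborel) = 1"
    using I by (simp add: \<psi>_def)
  ultimately have "bump \<psi>"
    using I E_pos by (auto simp: bump_def \<psi>_def)
  then show ?thesis by blast
qed

section \<open>Rescaled bump functions and the unit sphere measure\<close>

lemma bump_test_fun: "bump \<psi> \<Longrightarrow> \<psi> \<in> test_fun 1"
  using closure_subset[of "{x. \<psi> x \<noteq> 0}"] by (auto simp: bump_def test_fun_def)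

lemma rescale_test_fun:
  assumes "bump \<psi>" "n > 0"
  shows "rescale \<psi> n \<in> test_fun (1 / real n)"
  using test_fun_scale[OF bump_test_fun[OF assms(1)], of "real n" "real n ^ DIM('a)"] assms(2)
  by (simp add: rescale_def[abs_def])

lemma rescale_nonneg: "bump \<psi> \<Longrightarrow> rescale \<psi> n x \<ge> 0"
  by (auto simp: rescale_def bump_def)

lemma integral_rescale:
  fixes \<psi> :: "'a::euclidean_space \<Rightarrow> real"
  assumes "bump \<psi>" "n > 0"
  shows "(\<integral>x. rescale \<psi> n x \<partial>lborel) = 1"
proof -
  have [measurable]: "\<psi> \<in> borel_measurable borel"
    by (intro borel_measurable_continuous_onI test_fun_continuous[OF bump_test_fun[OF assms(1)]])
  have "1 = (\<integral>x. \<psi> x \<partial>density (distr lborel borel (\<lambda>x::'a. 0 + real n *\<^sub>R x)) (\<lambda>_. ennreal (\<bar>real n\<bar> ^ DIM('a))))"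
    using assms by (subst lborel_affine[of "real n" 0, symmetric]) (auto simp: bump_def)
  also have "\<dots> = (\<integral>x. rescale \<psi> n x \<partial>lborel)"
    by (subst integral_density) (auto simp: integral_distr rescale_def[abs_def])
  finally show ?thesis by simp
qed

text \<open>The norm bound is an inequality because the radial projection sends the origin to 0; all
  that is wanted is a radius for the support.\<close>

lemma unit_sphere_measure:
  shows "prob_space (unit_sphere_measure :: 'a::euclidean_space measure)"
    and "sets (unit_sphere_measure :: 'a measure) = sets borel"
    and "AE x in unit_sphere_measure. norm (x :: 'a) \<le> 1"
proof -
  have *: "prob_space (uniform_measure lborel (ball (0::'a) 1))"
    using content_ball_pos[of 1 "0::'a"]
    by (intro prob_space_uniform_measure)
       (auto simp: measure_def simp del: emeasure_lborel_ball_finite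
         intro: less_imp_neq[OF emeasure_lborel_ball_finite])
  have m: "(\<lambda>x::'a. x /\<^sub>R norm x) \<in> uniform_measure lborel (ball 0 1) \<rightarrow>\<^sub>M borel"
    by measurable
  show "prob_space (unit_sphere_measure :: 'a measure)"
    unfolding unit_sphere_measure_def by (rule prob_space.prob_space_distr[OF * m])
  show "sets (unit_sphere_measure :: 'a measure) = sets borel"
    by (simp add: unit_sphere_measure_def)
  show "AE x in unit_sphere_measure. norm (x :: 'a) \<le> 1"
    unfolding unit_sphere_measure_def
    by (subst AE_distr_iff[OF m]) (auto simp: field_simps)
qed

section \<open>Riesz potentials and logarithmic energy\<close>

text \<open>Divided by \<open>s + t\<close>, both summands lie in [0, 1], where u^p is at least
  u.\<close>

lemma powr_add_le:
  fixes s t :: real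
  assumes "0 \<le> s" "0 \<le> t" "0 < p" "p \<le> 1"
  shows "(s + t) powr p \<le> s powr p + t powr p"
proof (cases "s + t = 0")
  case True
  then show ?thesis using assms by simp
next
  case False
  then have pos: "s + t > 0" using assms by simp
  have *: "u powr p \<ge> u" if "0 \<le> u" "u \<le> 1" for u :: real
    using that assms powr_mono'[of p 1 u] by (cases "u = 0") auto
  have "1 = s / (s + t) + t / (s + t)"
    using pos by (simp add: add_divide_distrib[symmetric])
  also have "\<dots> \<le> (s / (s + t)) powr p + (t / (s + t)) powr p"
    using assms pos by (intro add_mono *) (auto simp: field_simps)
  also have "\<dots> = (s powr p + t powr p) / (s + t) powr p"
    using assms pos by (simp add: powr_divide add_divide_distrib)
  finally show ?thesis
    using pos by (simp add: field_simps)
qed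

text \<open>Subadditivity gives a^p \<le> b^p + d^p, and \<open>ln x \<le> x - 1\<close> at x =
  (a/b)^p converts this into a bound on the logarithm. The factor \<open>1 / p\<close> comes from ln
  x = p (ln a - ln b).\<close>

lemma ln_diff_le:
  fixes a b :: real
  assumes "a > 0" "b > 0" "0 < p" "p \<le> 1" "\<bar>a - b\<bar> \<le> d"
  shows "ln a - ln b \<le> d powr p * b powr (- p) / p"
proof -
  have "a powr p \<le> (b + d) powr p"
    using assms by (intro powr_mono2) auto
  also have "\<dots> \<le> b powr p + d powr p"
    using assms by (intro powr_add_le) auto
  finally have "a powr p / b powr p \<le> (b powr p + d powr p) / b powr p"
    by (intro divide_right_mono) auto
  then have "(a / b) powr p - 1 \<le> d powr p * b powr (- p)"
    using assms by (simp add: powr_divide powr_minus_divide add_divide_distrib)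
  moreover have "p * (ln a - ln b) \<le> (a / b) powr p - 1"
    using assms ln_le_minus_one[of "(a / b) powr p"] by (simp add: ln_powr ln_div)
  ultimately show ?thesis
    using assms by (simp add: field_simps)
qed

text \<open>The reciprocal is taken in \<open>ennreal\<close> so that the kernel is infinite at 0,
  where \<open>norm x powr (- p)\<close> would have the value 0. A finite integral can then exclude
  mass at the singularity.\<close>

definition riesz :: "real \<Rightarrow> 'a::real_normed_vector \<Rightarrow> ennreal" where
  "riesz p x = 1 / ennreal (norm x powr p)"

lemma riesz_0 [simp]: "riesz p 0 = \<infinity>"
  by (simp add: riesz_def ennreal_divide_zero)

lemma riesz_nonzero: "x \<noteq> 0 \<Longrightarrow> riesz p x = ennreal (norm x powr (- p))"
  by (simp add: riesz_def powr_minus divide_ennreal_def inverse_ennreal)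

lemma riesz_minus_commute: "riesz p (x - y) = riesz p (y - x)"
  by (simp add: riesz_def norm_minus_commute)

lemma riesz_scaleR:
  assumes "c > 0"
  shows "riesz p (c *\<^sub>R x) = ennreal (c powr (- p)) * riesz p x"
proof (cases "x = 0")
  case True
  then show ?thesis using assms by (simp add: ennreal_mult_top)
next
  case False
  then show ?thesis
    using assms by (simp add: riesz_nonzero powr_mult ennreal_mult)
qed

lemma riesz_measurable [measurable]: "riesz p \<in> borel_measurable (borel :: 'a::euclidean_space measure)"
  unfolding riesz_def[abs_def] by measurable

text \<open>As the kernel is infinite at 0, finiteness of its integral makes \<open>X\<close>
  nonzero almost everywhere, and away from 0 the kernel is an ordinary real power.\<close>

lemma
  fixes X :: "'b \<Rightarrow> 'a::euclidean_space"
  assumes [measurable]: "X \<in> Q \<rightarrow>\<^sub>M borel"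
    and riesz: "(\<integral>\<^sup>+\<omega>. riesz p (X \<omega>) \<partial>Q) \<le> ennreal S"
  shows AE_nonzero_of_riesz: "AE \<omega> in Q. X \<omega> \<noteq> 0"
    and integrable_of_riesz: "integrable Q (\<lambda>\<omega>. norm (X \<omega>) powr (- p))"
    and integral_of_riesz: "S \<ge> 0 \<Longrightarrow> (\<integral>\<omega>. norm (X \<omega>) powr (- p) \<partial>Q) \<le> S"
proof -
  have fin: "(\<integral>\<^sup>+\<omega>. riesz p (X \<omega>) \<partial>Q) < \<infinity>"
    using riesz by (rule le_less_trans) simp
  have "AE \<omega> in Q. riesz p (X \<omega>) \<noteq> \<infinity>"
    by (rule nn_integral_PInf_AE) (use fin in auto)
  then show nz: "AE \<omega> in Q. X \<omega> \<noteq> 0"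
    by eventually_elim auto
  then have eq: "(\<integral>\<^sup>+\<omega>. riesz p (X \<omega>) \<partial>Q) = (\<integral>\<^sup>+\<omega>. ennreal (norm (X \<omega>) powr (- p)) \<partial>Q)"
    by (intro nn_integral_cong_AE) (auto simp: riesz_nonzero)
  show int: "integrable Q (\<lambda>\<omega>. norm (X \<omega>) powr (- p))"
    using fin by (intro integrableI_bounded) (auto simp: eq)
  show "(\<integral>\<omega>. norm (X \<omega>) powr (- p) \<partial>Q) \<le> S" if "S \<ge> 0"
    using riesz nn_integral_eq_integral[OF int] that by (simp add: eq)
qed

text \<open>Large values of the norm are handled by ln t \<le> t and the bound \<open>R\<close>,
  small ones by -p ln t = ln (t^(-p)) \<le> t^(-p).\<close>

lemma integrable_ln_norm:
  fixes X :: "'b \<Rightarrow> 'a::euclidean_space"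
  assumes "finite_measure Q" and [measurable]: "X \<in> Q \<rightarrow>\<^sub>M borel" and "AE \<omega> in Q. norm (X \<omega>) \<le> R"
    and riesz: "(\<integral>\<^sup>+\<omega>. riesz p (X \<omega>) \<partial>Q) \<le> ennreal S" and p: "0 < p"
  shows "integrable Q (\<lambda>\<omega>. ln (norm (X \<omega>)))"
proof -
  interpret finite_measure Q by fact
  have "integrable Q (\<lambda>\<omega>. \<bar>R\<bar> + norm (X \<omega>) powr (- p) / p)"
    using integrable_of_riesz[OF assms(2) riesz] by simp
  then show ?thesis
  proof (rule Bochner_Integration.integrable_bound)
    show "AE \<omega> in Q. norm (ln (norm (X \<omega>))) \<le> norm (\<bar>R\<bar> + norm (X \<omega>) powr (- p) / p)"
      using assms(3) AE_nonzero_of_riesz[OF assms(2) riesz]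
    proof eventually_elim
      case (elim \<omega>)
      let ?x = "norm (X \<omega>)"
      have "ln ?x \<le> \<bar>R\<bar>"
        using elim ln_bound[of ?x] by simp
      moreover have "- p * ln ?x \<le> ?x powr (- p)"
        using elim ln_bound[of "?x powr (- p)"] by (simp add: ln_powr)
      then have "- ln ?x \<le> ?x powr (- p) / p"
        using p by (simp add: field_simps)
      moreover have "?x powr (- p) / p \<ge> 0" using p by simp
      ultimately show ?case by (simp add: abs_le_iff)
    qed
  qed simp
qed

text \<open>The pointwise bound carries the singularity of \<open>Y\<close> alone, so the final
  constant is \<open>S\<close>; the bound \<open>S'\<close> for \<open>X\<close> serves to make ln
  |X| integrable.\<close>

lemma expectation_ln_diff_le:
  fixes X Y :: "'b \<Rightarrow> 'a::euclidean_space"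
  assumes "finite_measure Q"
    and X: "X \<in> Q \<rightarrow>\<^sub>M borel" "AE \<omega> in Q. norm (X \<omega>) \<le> R" "(\<integral>\<^sup>+\<omega>. riesz p (X \<omega>) \<partial>Q) \<le> ennreal S'"
    and Y: "Y \<in> Q \<rightarrow>\<^sub>M borel" "AE \<omega> in Q. norm (Y \<omega>) \<le> R'" "(\<integral>\<^sup>+\<omega>. riesz p (Y \<omega>) \<partial>Q) \<le> ennreal S"
    and "S \<ge> 0" and near: "AE \<omega> in Q. norm (X \<omega> - Y \<omega>) \<le> d"
    and p: "0 < p" "p \<le> 1"
  shows "(\<integral>\<omega>. ln (norm (X \<omega>)) \<partial>Q) - (\<integral>\<omega>. ln (norm (Y \<omega>)) \<partial>Q) \<le> S * d powr p / p"
proof -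
  note [simp] = integrable_ln_norm[OF assms(1) X p(1)] integrable_ln_norm[OF assms(1) Y p(1)]
  note iY = integrable_of_riesz[OF Y(1,3)]
  have "(\<integral>\<omega>. ln (norm (X \<omega>)) \<partial>Q) - (\<integral>\<omega>. ln (norm (Y \<omega>)) \<partial>Q)
      = (\<integral>\<omega>. ln (norm (X \<omega>)) - ln (norm (Y \<omega>)) \<partial>Q)"
    by simp
  also have "\<dots> \<le> (\<integral>\<omega>. d powr p / p * norm (Y \<omega>) powr (- p) \<partial>Q)"
  proof (rule integral_mono_AE)
    show "AE \<omega> in Q. ln (norm (X \<omega>)) - ln (norm (Y \<omega>)) \<le> d powr p / p * norm (Y \<omega>) powr (- p)"
      using near AE_nonzero_of_riesz[OF X(1,3)] AE_nonzero_of_riesz[OF Y(1,3)]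
    proof eventually_elim
      case (elim \<omega>)
      then have "\<bar>norm (X \<omega>) - norm (Y \<omega>)\<bar> \<le> d"
        using norm_triangle_ineq3[of "X \<omega>" "Y \<omega>"] by linarith
      then show ?case
        using elim ln_diff_le[of "norm (X \<omega>)" "norm (Y \<omega>)" p d] p by simp
    qed
  qed (use iY in auto)
  also have "\<dots> = d powr p / p * (\<integral>\<omega>. norm (Y \<omega>) powr (- p) \<partial>Q)"
    by simp
  also have "\<dots> \<le> d powr p / p * S"
    using integral_of_riesz[OF Y(1,3) \<open>S \<ge> 0\<close>] p by (intro mult_left_mono) auto
  finally show ?thesis by (simp add: mult.commute)
qed

text \<open>Measures are represented by random variables so that two of them can be coupled on one
  space and compared pointwise. The bound is uniform in \<open>a\<close> so that it can be
  integrated over an independent variable.\<close>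

definition riesz_bounded :: "real \<Rightarrow> real \<Rightarrow> 'b measure \<Rightarrow> ('b \<Rightarrow> 'a::euclidean_space) \<Rightarrow> bool" where
  "riesz_bounded p S P X \<longleftrightarrow> (\<forall>a. (\<integral>\<^sup>+\<omega>. riesz p (a - X \<omega>) \<partial>P) \<le> ennreal S)"

definition bounded_rv :: "real \<Rightarrow> 'b measure \<Rightarrow> ('b \<Rightarrow> 'a::euclidean_space) \<Rightarrow> bool" where
  "bounded_rv R P X \<longleftrightarrow> X \<in> P \<rightarrow>\<^sub>M borel \<and> (AE \<omega> in P. norm (X \<omega>) \<le> R)"

text \<open>The integrand has the default value 0 on the diagonal. This is harmless under the Riesz
  bounds, which make the diagonal a null set of the product.\<close>

definition log_energy :: "'a::euclidean_space measure \<Rightarrow> 'a measure \<Rightarrow> real" where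
  "log_energy \<mu> \<nu> = (\<integral>(x, y). ln (1 / norm (x - y)) \<partial>(\<mu> \<Otimes>\<^sub>M \<nu>))"

lemma AE_pair_fst:
  assumes "prob_space Q" "AE x in P. A x"
  shows "AE z in P \<Otimes>\<^sub>M Q. A (fst z)"
proof (rule AE_distrD[OF measurable_fst])
  have "distr (P \<Otimes>\<^sub>M Q) P fst = P"
    by (rule prob_space.distr_pair_fst) fact
  then show "AE x in distr (P \<Otimes>\<^sub>M Q) P fst. A x"
    using assms(2) by (rule ssubst)
qed

lemma AE_pair_snd:
  assumes "prob_space P" "prob_space Q" "AE x in Q. A x"
  shows "AE z in P \<Otimes>\<^sub>M Q. A (snd z)"
proof -
  interpret P: prob_space P by fact
  interpret Q: prob_space Q by fact
  interpret Q_P: pair_sigma_finite Q P ..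
  have "AE z in Q \<Otimes>\<^sub>M P. A (fst z)"
    by (rule AE_pair_fst) fact+
  then have "AE z in distr (P \<Otimes>\<^sub>M Q) (Q \<Otimes>\<^sub>M P) (\<lambda>(x, y). (y, x)). A (fst z)"
    by (subst (asm) Q_P.distr_pair_swap)
  from AE_distrD[OF measurable_pair_swap' this] show ?thesis
    by (simp add: case_prod_beta)
qed

text \<open>By Fubini the inner integral over \<open>X\<close> is at most \<open>S\<close> for each
  value of \<open>Y\<close>, whatever the law of \<open>Y\<close>.\<close>

lemma riesz_pair_le:
  fixes X Y :: "_ \<Rightarrow> 'a::euclidean_space"
  assumes "prob_space P" "prob_space Q" and [measurable]: "X \<in> P \<rightarrow>\<^sub>M borel" "Y \<in> Q \<rightarrow>\<^sub>M borel"
    and X: "riesz_bounded p S P X"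
  shows "(\<integral>\<^sup>+z. riesz p (X (fst z) - Y (snd z)) \<partial>(P \<Otimes>\<^sub>M Q)) \<le> ennreal S"
proof -
  interpret P: prob_space P by fact
  interpret Q: prob_space Q by fact
  interpret pair_sigma_finite P Q ..
  have "(\<integral>\<^sup>+z. riesz p (X (fst z) - Y (snd z)) \<partial>(P \<Otimes>\<^sub>M Q))
      = (\<integral>\<^sup>+y. (\<integral>\<^sup>+x. riesz p (Y y - X x) \<partial>P) \<partial>Q)"
    by (subst nn_integral_snd[symmetric]) (auto simp: riesz_minus_commute[of p "X _"])
  also have "\<dots> \<le> (\<integral>\<^sup>+y. ennreal S \<partial>Q)"
    using X by (intro nn_integral_mono) (simp add: riesz_bounded_def)
  finally show ?thesis
    by (simp add: Q.emeasure_space_1)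
qed

lemma pair_diff_bounded_rv:
  assumes "prob_space P" "prob_space Q" "bounded_rv R P X" "bounded_rv R' Q Y"
  shows "bounded_rv (R + R') (P \<Otimes>\<^sub>M Q) (\<lambda>z. X (fst z) - Y (snd z))"
proof -
  have [measurable]: "X \<in> P \<rightarrow>\<^sub>M borel" "Y \<in> Q \<rightarrow>\<^sub>M borel"
    using assms by (auto simp: bounded_rv_def)
  have "AE z in P \<Otimes>\<^sub>M Q. norm (X (fst z)) \<le> R" "AE z in P \<Otimes>\<^sub>M Q. norm (Y (snd z)) \<le> R'"
    using assms by (auto simp: bounded_rv_def intro!: AE_pair_fst[where A = "\<lambda>x. norm (X x) \<le> R"]
        AE_pair_snd[where A = "\<lambda>x. norm (Y x) \<le> R'"])
  then have "AE z in P \<Otimes>\<^sub>M Q. norm (X (fst z) - Y (snd z)) \<le> R + R'"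
    by eventually_elim (metis add_mono norm_triangle_ineq4 order_trans)
  then show ?thesis
    by (auto simp: bounded_rv_def)
qed

lemma log_energy_distr:
  fixes X Y :: "_ \<Rightarrow> 'a::euclidean_space"
  assumes "prob_space P" "prob_space Q" and [measurable]: "X \<in> P \<rightarrow>\<^sub>M borel" "Y \<in> Q \<rightarrow>\<^sub>M borel"
  shows "log_energy (distr P borel X) (distr Q borel Y)
    = - (\<integral>z. ln (norm (X (fst z) - Y (snd z))) \<partial>(P \<Otimes>\<^sub>M Q))"
proof -
  interpret prob_space "distr Q borel Y"
    using assms by (intro prob_space.prob_space_distr)
  have "log_energy (distr P borel X) (distr Q borel Y) =
      (\<integral>z. - ln (norm (fst z - snd z)) \<partial>distr (P \<Otimes>\<^sub>M Q) (borel \<Otimes>\<^sub>M borel) (\<lambda>(x, y). (X x, Y y)))"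
    unfolding log_energy_def
    by (subst pair_measure_distr)
       (simp_all add: case_prod_beta' inverse_eq_divide[symmetric] ln_inverse sigma_finite_measure_axioms)
  also have "\<dots> = - (\<integral>z. ln (norm (X (fst z) - Y (snd z))) \<partial>(P \<Otimes>\<^sub>M Q))"
    by (subst integral_distr) (auto simp: case_prod_beta)
  finally show ?thesis .
qed

text \<open>This is the Hoelder estimate of the energy in coupled form. On the product space the two
  differences of points are at distance at most \<open>d + d'\<close>. Since the energy is minus the
  expected logarithm, the constant \<open>S\<close> is that of \<open>X0\<close>, which sits in the
  positive term.\<close>

lemma log_energy_diff_le:
  fixes X X0 :: "'b \<Rightarrow> 'a::euclidean_space" and Y Y0 :: "'c \<Rightarrow> 'a"
  assumes "prob_space P" "prob_space Q"
    and rv: "bounded_rv R P X" "bounded_rv R P X0" "bounded_rv R Q Y" "bounded_rv R Q Y0"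
    and riesz: "riesz_bounded p S' P X" "riesz_bounded p S P X0" and "S \<ge> 0"
    and near: "AE \<omega> in P. norm (X \<omega> - X0 \<omega>) \<le> d" "AE \<omega> in Q. norm (Y \<omega> - Y0 \<omega>) \<le> d'"
    and p: "0 < p" "p \<le> 1"
  shows "log_energy (distr P borel X0) (distr Q borel Y0) - log_energy (distr P borel X) (distr Q borel Y)
    \<le> S * (d + d') powr p / p"
proof -
  have [measurable]: "X \<in> P \<rightarrow>\<^sub>M borel" "X0 \<in> P \<rightarrow>\<^sub>M borel" "Y \<in> Q \<rightarrow>\<^sub>M borel" "Y0 \<in> Q \<rightarrow>\<^sub>M borel"
    using rv by (auto simp: bounded_rv_def)
  interpret P: prob_space P by fact
  interpret Q: prob_space Q by fact
  interpret PQ: pair_prob_space P Q ..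
  have "AE z in P \<Otimes>\<^sub>M Q. norm (X (fst z) - X0 (fst z)) \<le> d" "AE z in P \<Otimes>\<^sub>M Q. norm (Y (snd z) - Y0 (snd z)) \<le> d'"
    using near by (auto intro!: AE_pair_fst[where A = "\<lambda>x. norm (X x - X0 x) \<le> d"]
        AE_pair_snd[where A = "\<lambda>x. norm (Y x - Y0 x) \<le> d'"] assms(1,2))
  then have *: "AE z in P \<Otimes>\<^sub>M Q. norm ((X (fst z) - Y (snd z)) - (X0 (fst z) - Y0 (snd z))) \<le> d + d'"
  proof eventually_elim
    case (elim z)
    have eq: "(X (fst z) - Y (snd z)) - (X0 (fst z) - Y0 (snd z)) = (X (fst z) - X0 (fst z)) - (Y (snd z) - Y0 (snd z))"
      by simp
    show ?case
      unfolding eq using elim norm_triangle_ineq4[of "X (fst z) - X0 (fst z)" "Y (snd z) - Y0 (snd z)"] by linarith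
  qed
  have "(\<integral>z. ln (norm (X (fst z) - Y (snd z))) \<partial>(P \<Otimes>\<^sub>M Q))
      - (\<integral>z. ln (norm (X0 (fst z) - Y0 (snd z))) \<partial>(P \<Otimes>\<^sub>M Q)) \<le> S * (d + d') powr p / p"
    using pair_diff_bounded_rv[OF assms(1,2) rv(1,3)] pair_diff_bounded_rv[OF assms(1,2) rv(2,4)]
    by (intro expectation_ln_diff_le[OF PQ.finite_measure_axioms _ _ riesz_pair_le[OF assms(1,2) _ _ riesz(1)]
          _ _ riesz_pair_le[OF assms(1,2) _ _ riesz(2)] \<open>S \<ge> 0\<close> * p]) (auto simp: bounded_rv_def)
  then show ?thesis
    by (simp add: log_energy_distr assms(1,2))
qed

lemma integrable_log_kernel:
  fixes X Y :: "_ \<Rightarrow> 'a::euclidean_space"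
  assumes "prob_space P" "prob_space Q" "bounded_rv R P X" "bounded_rv R' Q Y"
    and riesz: "riesz_bounded p S P X" and p: "0 < p"
  shows "integrable (P \<Otimes>\<^sub>M Q) (\<lambda>z. ln (norm (X (fst z) - Y (snd z))))"
proof -
  have [measurable]: "X \<in> P \<rightarrow>\<^sub>M borel" "Y \<in> Q \<rightarrow>\<^sub>M borel"
    using assms by (auto simp: bounded_rv_def)
  interpret P: prob_space P by fact
  interpret Q: prob_space Q by fact
  interpret PQ: pair_prob_space P Q ..
  show ?thesis
    using pair_diff_bounded_rv[OF assms(1-4)]
    by (intro integrable_ln_norm[OF PQ.finite_measure_axioms _ _ riesz_pair_le[OF assms(1,2) _ _ riesz] p])
       (auto simp: bounded_rv_def)
qed

section \<open>Logarithmic energy of smoothed measures\<close>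

text \<open>This class is stable under smoothing: an independent bounded displacement enlarges
  \<open>R\<close> and leaves \<open>S\<close> unchanged.\<close>

definition spread :: "real \<Rightarrow> real \<Rightarrow> real \<Rightarrow> 'a::euclidean_space measure \<Rightarrow> bool" where
  "spread p S R \<mu> \<longleftrightarrow> prob_space \<mu> \<and> sets \<mu> = sets borel \<and> (AE y in \<mu>. norm y \<le> R) \<and>
     riesz_bounded p S \<mu> (\<lambda>y. y)"

text \<open>An abstraction of \<open>rescale \<psi> n\<close> with \<open>d = 1 / n\<close>, which
  allows two different bump functions at two different scales to be compared.\<close>

definition mollifier :: "real \<Rightarrow> ('a::euclidean_space \<Rightarrow> real) \<Rightarrow> bool" where
  "mollifier d \<phi> \<longleftrightarrow> \<phi> \<in> test_fun d \<and> (\<forall>x. \<phi> x \<ge> 0) \<and> (\<integral>x. \<phi> x \<partial>lborel) = 1"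

lemma mollifier_rescale: "bump \<psi> \<Longrightarrow> n > 0 \<Longrightarrow> mollifier (1 / real n) (rescale \<psi> n)"
  by (simp add: mollifier_def rescale_test_fun rescale_nonneg integral_rescale)

lemma mollifier_measurable [measurable_dest]: "mollifier d \<phi> \<Longrightarrow> \<phi> \<in> borel_measurable borel"
  by (intro borel_measurable_continuous_onI test_fun_continuous) (auto simp: mollifier_def)

lemma
  fixes \<phi> :: "'a::euclidean_space \<Rightarrow> real"
  assumes "mollifier d \<phi>"
  shows mollifier_prob_space: "prob_space (density lborel \<phi>)"
    and mollifier_AE_norm_le: "AE x in density lborel \<phi>. norm x \<le> d"
proof -
  have \<phi>: "\<phi> \<in> test_fun d" "\<And>x. \<phi> x \<ge> 0" "(\<integral>x. \<phi> x \<partial>lborel) = 1"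
    using assms by (auto simp: mollifier_def)
  have [measurable]: "\<phi> \<in> borel_measurable borel"
    using assms by measurable
  have "(\<integral>\<^sup>+x. \<phi> x \<partial>lborel) = ennreal 1"
    using \<phi> nn_integral_eq_integral[OF test_fun_integrable[OF \<phi>(1)]] by simp
  then show "prob_space (density lborel \<phi>)"
    by (intro prob_spaceI) (simp add: emeasure_density)
  show "AE x in density lborel \<phi>. norm x \<le> d"
    using \<phi> by (subst AE_density) (auto simp: test_fun_def intro!: AE_I2 leI)
qed

text \<open>Smoothing becomes a random displacement: the smoothed measure is the law of a sum of
  independent variables, coupled with the original first summand. This makes the estimate
  \<open>log_energy_diff_le\<close> applicable.\<close>

lemma density_convolve:
  fixes \<mu> :: "'a::euclidean_space measure"
  assumes "prob_space \<mu>" and sets [measurable_cong]: "sets \<mu> = sets borel" and \<phi>: "mollifier d \<phi>"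
  shows "density lborel (convolve \<mu> \<phi>) = distr (\<mu> \<Otimes>\<^sub>M density lborel \<phi>) borel (\<lambda>z. fst z + snd z)"
proof (rule measure_eqI)
  interpret prob_space \<mu> by fact
  interpret D: prob_space "density lborel \<phi>" by (rule mollifier_prob_space[OF \<phi>])
  interpret pair_sigma_finite \<mu> "lborel :: 'a measure" ..
  have [measurable]: "\<phi> \<in> borel_measurable borel"
    using \<phi> by measurable
  have pos: "\<And>x. \<phi> x \<ge> 0"
    using \<phi> by (simp add: mollifier_def)
  obtain B where B: "\<And>x. \<bar>\<phi> x\<bar> \<le> B"
    using test_fun_bounded[of \<phi> d] \<phi> unfolding mollifier_def by metis
  have conv: "ennreal (convolve \<mu> \<phi> x) = (\<integral>\<^sup>+y. \<phi> (x - y) \<partial>\<mu>)" for x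
    unfolding convolve_def
    by (rule nn_integral_eq_integral[symmetric, OF integrable_const_bound[where B = B]])
       (use pos B in auto)
  have [measurable]: "convolve \<mu> \<phi> \<in> borel_measurable borel"
    unfolding convolve_def[abs_def] by measurable
  fix A assume "A \<in> sets (density lborel (convolve \<mu> \<phi>))"
  then have [measurable]: "A \<in> sets borel" by simp
  have "emeasure (density lborel (convolve \<mu> \<phi>)) A
      = (\<integral>\<^sup>+x. (\<integral>\<^sup>+y. ennreal (\<phi> (x - y)) * indicator A x \<partial>\<mu>) \<partial>lborel)"
    by (simp add: emeasure_density conv nn_integral_multc)
  also have "\<dots> = (\<integral>\<^sup>+y. (\<integral>\<^sup>+x. ennreal (\<phi> (x - y)) * indicator A x \<partial>lborel) \<partial>\<mu>)"
    by (rule Fubini') measurable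
  also have "\<dots> = (\<integral>\<^sup>+y. (\<integral>\<^sup>+x. ennreal (\<phi> x) * indicator A (y + x) \<partial>lborel) \<partial>\<mu>)"
  proof (rule nn_integral_cong)
    fix y
    have "(\<integral>\<^sup>+x. ennreal (\<phi> (x - y)) * indicator A x \<partial>lborel)
        = (\<integral>\<^sup>+x. ennreal (\<phi> (x - y)) * indicator A x \<partial>distr lborel borel ((+) y))"
      by (simp add: lborel_distr_plus)
    also have "\<dots> = (\<integral>\<^sup>+x. ennreal (\<phi> x) * indicator A (y + x) \<partial>lborel)"
      by (subst nn_integral_distr) auto
    finally show "(\<integral>\<^sup>+x. ennreal (\<phi> (x - y)) * indicator A x \<partial>lborel) = (\<integral>\<^sup>+x. ennreal (\<phi> x) * indicator A (y + x) \<partial>lborel)" .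
  qed
  also have "\<dots> = (\<integral>\<^sup>+y. (\<integral>\<^sup>+x. indicator A (y + x) \<partial>density lborel \<phi>) \<partial>\<mu>)"
    by (subst nn_integral_density) auto
  also have "\<dots> = (\<integral>\<^sup>+z. indicator A (fst z + snd z) \<partial>(\<mu> \<Otimes>\<^sub>M density lborel \<phi>))"
    by (subst D.nn_integral_fst[symmetric]) auto
  also have "\<dots> = (\<integral>\<^sup>+z. indicator A z \<partial>distr (\<mu> \<Otimes>\<^sub>M density lborel \<phi>) borel (\<lambda>z. fst z + snd z))"
    by (subst nn_integral_distr) auto
  finally show "emeasure (density lborel (convolve \<mu> \<phi>)) A
      = emeasure (distr (\<mu> \<Otimes>\<^sub>M density lborel \<phi>) borel (\<lambda>z. fst z + snd z)) A"
    by simp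
qed simp

lemma prob_space_density_convolve:
  fixes \<mu> :: "'a::euclidean_space measure"
  assumes "prob_space \<mu>" "sets \<mu> = sets borel" "mollifier d \<phi>"
  shows "prob_space (density lborel (convolve \<mu> \<phi>))"
proof -
  note [measurable_cong] = assms(2)
  interpret \<mu>: prob_space \<mu> by fact
  interpret D: prob_space "density lborel \<phi>" by (rule mollifier_prob_space[OF assms(3)])
  interpret P: pair_prob_space \<mu> "density lborel \<phi>" ..
  show ?thesis
    unfolding density_convolve[OF assms] by (rule P.prob_space_distr) measurable
qed

lemma convolve_nonneg: "(\<And>x. \<phi> x \<ge> 0) \<Longrightarrow> convolve \<mu> \<phi> x \<ge> 0"
  unfolding convolve_def by simp

lemma integral_convolve:
  fixes \<mu> :: "'a::euclidean_space measure"
  assumes "prob_space \<mu>" "sets \<mu> = sets borel" "AE y in \<mu>. norm y \<le> R" "mollifier d \<phi>"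
  shows "(\<integral>x. convolve \<mu> \<phi> x \<partial>lborel) = 1"
proof -
  have t: "convolve \<mu> \<phi> \<in> test_fun (d + R)"
    using assms by (intro test_fun_convolve) (auto simp: mollifier_def)
  have [measurable]: "convolve \<mu> \<phi> \<in> borel_measurable borel"
    by (intro borel_measurable_continuous_onI test_fun_continuous[OF t])
  interpret prob_space "density lborel (convolve \<mu> \<phi>)"
    by (rule prob_space_density_convolve) fact+
  have "(\<integral>\<^sup>+x. convolve \<mu> \<phi> x \<partial>lborel) = 1"
    using emeasure_space_1 by (simp add: emeasure_density)
  then show ?thesis
    using assms(4) by (subst integral_eq_nn_integral) (auto simp: mollifier_def intro!: convolve_nonneg)
qed

section \<open>Adding independent noise to a measure\<close>

context
  fixes \<mu> \<beta> :: "'a::euclidean_space measure" and p S R d :: real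
  assumes \<mu>: "spread p S R \<mu>" and \<beta>: "prob_space \<beta>" "sets \<beta> = sets borel" "AE x in \<beta>. norm x \<le> d"
begin

interpretation \<mu>: prob_space \<mu> using \<mu> by (simp add: spread_def)
interpretation \<beta>: prob_space \<beta> by (rule \<beta>)
interpretation P: pair_prob_space \<mu> \<beta> ..

lemma sets_spread [measurable_cong]: "sets \<mu> = sets borel"
  using \<mu> by (simp add: spread_def)

lemmas [measurable_cong] = \<beta>(2)

lemma AE_fst_le: "AE z in \<mu> \<Otimes>\<^sub>M \<beta>. norm (fst z) \<le> R"
  using \<mu> by (intro AE_pair_fst[OF \<beta>(1), where A = "\<lambda>x. norm x \<le> R"]) (simp add: spread_def)

lemma AE_snd_le: "AE z in \<mu> \<Otimes>\<^sub>M \<beta>. norm (snd z) \<le> d"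
  by (rule AE_pair_snd[OF \<mu>.prob_space_axioms \<beta>(1) \<beta>(3)])

lemma bounded_rv_fst: "bounded_rv R (\<mu> \<Otimes>\<^sub>M \<beta>) fst"
  using AE_fst_le by (simp add: bounded_rv_def)

lemma bounded_rv_add: "bounded_rv (R + d) (\<mu> \<Otimes>\<^sub>M \<beta>) (\<lambda>z. fst z + snd z)"
proof -
  have "AE z in \<mu> \<Otimes>\<^sub>M \<beta>. norm (fst z + snd z) \<le> R + d"
    using AE_fst_le AE_snd_le by eventually_elim (metis add_mono norm_triangle_ineq order_trans)
  then show ?thesis by (simp add: bounded_rv_def)
qed

text \<open>For a fixed second component the shift only moves the centre \<open>a\<close>, and the
  bound holds at every centre. The cases of interest are the zero map, for the original variable,
  and the identity, for the smoothed one.\<close>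

lemma riesz_bounded_shift:
  assumes [measurable]: "c \<in> borel \<rightarrow>\<^sub>M borel"
  shows "riesz_bounded p S (\<mu> \<Otimes>\<^sub>M \<beta>) (\<lambda>z. fst z + c (snd z))"
  unfolding riesz_bounded_def
proof
  fix a :: 'a
  have "(\<integral>\<^sup>+z. riesz p (a - (fst z + c (snd z))) \<partial>(\<mu> \<Otimes>\<^sub>M \<beta>))
      = (\<integral>\<^sup>+s. (\<integral>\<^sup>+y. riesz p ((a - c s) - y) \<partial>\<mu>) \<partial>\<beta>)"
    by (subst P.nn_integral_snd[symmetric]) (auto simp: algebra_simps)
  also have "\<dots> \<le> (\<integral>\<^sup>+s. ennreal S \<partial>\<beta>)"
    using \<mu> by (intro nn_integral_mono) (simp add: spread_def riesz_bounded_def)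
  finally show "(\<integral>\<^sup>+z. riesz p (a - (fst z + c (snd z))) \<partial>(\<mu> \<Otimes>\<^sub>M \<beta>)) \<le> ennreal S"
    by (simp add: \<beta>.emeasure_space_1)
qed

lemma riesz_bounded_fst: "riesz_bounded p S (\<mu> \<Otimes>\<^sub>M \<beta>) fst"
  using riesz_bounded_shift[of "\<lambda>_. 0"] by simp

lemma riesz_bounded_add: "riesz_bounded p S (\<mu> \<Otimes>\<^sub>M \<beta>) (\<lambda>z. fst z + snd z)"
  using riesz_bounded_shift[of "\<lambda>s. s"] by simp

lemma distr_fst: "distr (\<mu> \<Otimes>\<^sub>M \<beta>) borel fst = \<mu>"
  using \<beta>.distr_pair_fst[of \<mu>] sets_spread by (metis distr_cong)

lemma spread_add: "spread p S (R + d) (distr (\<mu> \<Otimes>\<^sub>M \<beta>) borel (\<lambda>z. fst z + snd z))"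
  using bounded_rv_add riesz_bounded_add
  by (auto simp: spread_def riesz_bounded_def bounded_rv_def nn_integral_distr AE_distr_iff
      intro!: P.prob_space_distr)

end

lemma spread_prob_space: "spread p S R \<mu> \<Longrightarrow> prob_space \<mu>"
  by (simp add: spread_def)

lemma spread_convolve:
  assumes "spread p S R \<mu>" "mollifier d \<phi>"
  shows "spread p S (R + d) (density lborel (convolve \<mu> \<phi>))"
  using spread_add[OF assms(1) mollifier_prob_space[OF assms(2)] _ mollifier_AE_norm_le[OF assms(2)]] assms
  by (subst density_convolve[OF _ _ assms(2)]) (auto simp: spread_def)

lemma bounded_rv_mono: "bounded_rv R P X \<Longrightarrow> R \<le> R' \<Longrightarrow> bounded_rv R' P X"
  by (auto simp: bounded_rv_def)

text \<open>Each sum differs from its first summand by noise of norm at most \<open>d\<close> or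
  \<open>e\<close>. Original and smoothed variables share the Riesz constant \<open>S\<close>, so
  the one-sided estimate can be applied in both directions.\<close>

lemma log_energy_convolve:
  fixes \<mu> \<nu> :: "'a::euclidean_space measure"
  assumes \<mu>: "spread p S R \<mu>" and \<nu>: "spread p S' R' \<nu>" and \<phi>: "mollifier d \<phi>" and \<phi>': "mollifier e \<phi>'"
    and S: "S \<ge> 0" and p: "0 < p" "p \<le> 1"
  shows "\<bar>log_energy (density lborel (convolve \<mu> \<phi>)) (density lborel (convolve \<nu> \<phi>')) - log_energy \<mu> \<nu>\<bar>
    \<le> S * (d + e) powr p / p"
proof -
  let ?P = "\<mu> \<Otimes>\<^sub>M density lborel \<phi>" and ?Q = "\<nu> \<Otimes>\<^sub>M density lborel \<phi>'"
  let ?s = "\<lambda>z::'a \<times> 'a. fst z + snd z"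
  let ?R = "max (max R (R + d)) (max R' (R' + e))"
  note P = \<mu> mollifier_prob_space[OF \<phi>] _ mollifier_AE_norm_le[OF \<phi>]
  note Q = \<nu> mollifier_prob_space[OF \<phi>'] _ mollifier_AE_norm_le[OF \<phi>']
  have 1: "prob_space ?P" "prob_space ?Q"
    using \<mu> \<nu> mollifier_prob_space[OF \<phi>] mollifier_prob_space[OF \<phi>']
    by (auto intro!: prob_space_pair intro: spread_prob_space)
  have 2: "bounded_rv ?R ?P ?s" "bounded_rv ?R ?P fst" "bounded_rv ?R ?Q ?s" "bounded_rv ?R ?Q fst"
    by (rule bounded_rv_mono[OF bounded_rv_add[OF P]] bounded_rv_mono[OF bounded_rv_fst[OF P]]
        bounded_rv_mono[OF bounded_rv_add[OF Q]] bounded_rv_mono[OF bounded_rv_fst[OF Q]]; simp)+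
  have 3: "riesz_bounded p S ?P ?s" "riesz_bounded p S ?P fst"
    by (rule riesz_bounded_add[OF P] riesz_bounded_fst[OF P]; simp)+
  have 4: "AE z in ?P. norm (snd z) \<le> d" "AE z in ?Q. norm (snd z) \<le> e"
    by (rule AE_snd_le[OF P] AE_snd_le[OF Q]; simp)+
  have 5: "distr ?P borel fst = \<mu>" "distr ?Q borel fst = \<nu>"
    by (rule distr_fst[OF P] distr_fst[OF Q]; simp)+
  have 6: "density lborel (convolve \<mu> \<phi>) = distr ?P borel ?s" "density lborel (convolve \<nu> \<phi>') = distr ?Q borel ?s"
    using \<mu> \<nu> \<phi> \<phi>' by (auto simp: spread_def intro!: density_convolve)
  have "log_energy (distr ?P borel fst) (distr ?Q borel fst) - log_energy (distr ?P borel ?s) (distr ?Q borel ?s)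
      \<le> S * (d + e) powr p / p"
    using 4 by (intro log_energy_diff_le[OF 1 2 3 S _ _ p]) auto
  moreover have "log_energy (distr ?P borel ?s) (distr ?Q borel ?s) - log_energy (distr ?P borel fst) (distr ?Q borel fst)
      \<le> S * (d + e) powr p / p"
    using 4 by (intro log_energy_diff_le[OF 1 2(2,1,4,3) 3(2,1) S _ _ p]) auto
  ultimately show ?thesis
    unfolding 5 6 by (simp add: abs_le_iff)
qed

section \<open>Energies of densities and the covariance integral\<close>

lemma
  fixes f g :: "'a::euclidean_space \<Rightarrow> real"
  assumes f: "spread p S R (density lborel f)" and g: "spread p S' R' (density lborel g)"
    and [measurable]: "f \<in> borel_measurable borel" "g \<in> borel_measurable borel"
    and pos: "\<And>x. f x \<ge> 0" "\<And>x. g x \<ge> 0" and p: "0 < p"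
  shows integrable_log_kernel_density:
      "integrable (lborel \<Otimes>\<^sub>M lborel) (\<lambda>(x, y). ln (1 / norm (x - y)) * f x * g y)"
    and log_energy_density: "(\<integral>(x, y). ln (1 / norm (x - y)) * f x * g y \<partial>(lborel \<Otimes>\<^sub>M lborel))
      = log_energy (density lborel f) (density lborel g)"
proof -
  interpret G: prob_space "density lborel g" using g by (rule spread_prob_space)
  have eq: "density lborel f \<Otimes>\<^sub>M density lborel g = density (lborel \<Otimes>\<^sub>M lborel) (\<lambda>z. ennreal (f (fst z) * g (snd z)))"
    by (subst pair_measure_density)
       (auto simp: case_prod_beta' ennreal_mult pos lborel.sigma_finite_measure_axioms G.sigma_finite_measure_axioms)
  have M: "borel_measurable (lborel \<Otimes>\<^sub>M lborel) = (borel_measurable (borel \<Otimes>\<^sub>M borel) :: ('a \<times> 'a \<Rightarrow> real) set)"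
    by (intro measurable_cong_sets sets_pair_measure_cong sets_lborel refl)
  have [measurable]: "(\<lambda>z. ln (1 / norm (fst z - snd z))) \<in> borel_measurable (lborel \<Otimes>\<^sub>M (lborel :: 'a measure))"
    "(\<lambda>z. f (fst z) * g (snd z)) \<in> borel_measurable (lborel \<Otimes>\<^sub>M lborel)"
    unfolding M by measurable
  have "integrable (density lborel f \<Otimes>\<^sub>M density lborel g) (\<lambda>z. ln (norm (fst z - snd z)))"
    using f g by (intro integrable_log_kernel[where p = p and S = S and R = R and R' = R'])
      (auto simp: spread_def bounded_rv_def p)
  then have "integrable (density lborel f \<Otimes>\<^sub>M density lborel g) (\<lambda>z. ln (1 / norm (fst z - snd z)))"
    by (simp add: inverse_eq_divide[symmetric] ln_inverse)
  then have "integrable (lborel \<Otimes>\<^sub>M lborel) (\<lambda>z. (f (fst z) * g (snd z)) * ln (1 / norm (fst z - snd z)))"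
    unfolding eq by (subst (asm) integrable_density) (auto simp: pos)
  then show "integrable (lborel \<Otimes>\<^sub>M lborel) (\<lambda>(x, y). ln (1 / norm (x - y)) * f x * g y)"
    by (simp add: case_prod_beta' mult_ac)
  have "log_energy (density lborel f) (density lborel g)
      = (\<integral>z. (f (fst z) * g (snd z)) * ln (1 / norm (fst z - snd z)) \<partial>(lborel \<Otimes>\<^sub>M lborel))"
    unfolding log_energy_def eq case_prod_beta' by (subst integral_density) (auto simp: pos)
  then show "(\<integral>(x, y). ln (1 / norm (x - y)) * f x * g y \<partial>(lborel \<Otimes>\<^sub>M lborel))
      = log_energy (density lborel f) (density lborel g)"
    by (simp add: case_prod_beta' mult_ac)
qed

text \<open>The bilinear expansion may be integrated term by term because the Riesz bounds make each
  of the four kernels integrable on its own.\<close>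

lemma log_energy_density_diff:
  fixes f g :: "'a::euclidean_space \<Rightarrow> real"
  assumes f: "spread p S R (density lborel f)" and g: "spread p S' R' (density lborel g)"
    and meas: "f \<in> borel_measurable borel" "g \<in> borel_measurable borel"
    and pos: "\<And>x. f x \<ge> 0" "\<And>x. g x \<ge> 0" and p: "0 < p"
  shows "(\<integral>(x, y). ln (1 / norm (x - y)) * (f x - g x) * (f y - g y) \<partial>(lborel \<Otimes>\<^sub>M lborel))
    = log_energy (density lborel f) (density lborel f) - log_energy (density lborel f) (density lborel g)
      - log_energy (density lborel g) (density lborel f) + log_energy (density lborel g) (density lborel g)"
proof -
  let ?K = "\<lambda>f g z. case z of (x, y) \<Rightarrow> ln (1 / norm (x - y)) * f x * g y"
  note i = integrable_log_kernel_density[OF f f meas(1,1) pos(1,1) p] integrable_log_kernel_density[OF f g meas pos p]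
    integrable_log_kernel_density[OF g f meas(2,1) pos(2,1) p] integrable_log_kernel_density[OF g g meas(2,2) pos(2,2) p]
  have "(\<integral>(x, y). ln (1 / norm (x - y)) * (f x - g x) * (f y - g y) \<partial>(lborel \<Otimes>\<^sub>M lborel))
      = (\<integral>z. ?K f f z - ?K f g z - ?K g f z + ?K g g z \<partial>(lborel \<Otimes>\<^sub>M lborel))"
    by (intro Bochner_Integration.integral_cong refl) (auto simp: algebra_simps)
  also have "\<dots> = (\<integral>z. ?K f f z \<partial>(lborel \<Otimes>\<^sub>M lborel)) - (\<integral>z. ?K f g z \<partial>(lborel \<Otimes>\<^sub>M lborel))
      - (\<integral>z. ?K g f z \<partial>(lborel \<Otimes>\<^sub>M lborel)) + (\<integral>z. ?K g g z \<partial>(lborel \<Otimes>\<^sub>M lborel))"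
    using i by (simp only: Bochner_Integration.integral_add Bochner_Integration.integral_diff
        Bochner_Integration.integrable_diff)
  finally show ?thesis
    by (simp only: log_energy_density[OF f f meas(1,1) pos(1,1) p] log_energy_density[OF f g meas pos p]
      log_energy_density[OF g f meas(2,1) pos(2,1) p] log_energy_density[OF g g meas(2,2) pos(2,2) p])
qed

section \<open>Mean square convergence\<close>

lemma square_add_le: "((a::real) + b)\<^sup>2 \<le> 2 * a\<^sup>2 + 2 * b\<^sup>2"
  using zero_le_power2[of "a - b"] by (simp add: power2_eq_square algebra_simps)

lemma L2_space_add:
  assumes "X \<in> L2_space M" "Y \<in> L2_space M"
  shows "(\<lambda>\<omega>. X \<omega> + Y \<omega>) \<in> L2_space M"
proof -
  have [measurable]: "X \<in> borel_measurable M" "Y \<in> borel_measurable M"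
    using assms by (auto simp: L2_space_def)
  have "integrable M (\<lambda>\<omega>. 2 * (X \<omega>)\<^sup>2 + 2 * (Y \<omega>)\<^sup>2)"
    using assms by (auto simp: L2_space_def)
  then have "integrable M (\<lambda>\<omega>. (X \<omega> + Y \<omega>)\<^sup>2)"
    by (rule Bochner_Integration.integrable_bound) (auto intro!: AE_I2 square_add_le)
  then show ?thesis
    by (simp add: L2_space_def)
qed

lemma L2_space_uminus: "X \<in> L2_space M \<Longrightarrow> (\<lambda>\<omega>. - X \<omega>) \<in> L2_space M"
  by (auto simp: L2_space_def)

lemma L2_space_diff: "X \<in> L2_space M \<Longrightarrow> Y \<in> L2_space M \<Longrightarrow> (\<lambda>\<omega>. X \<omega> - Y \<omega>) \<in> L2_space M"
  using L2_space_add[OF _ L2_space_uminus, of X M Y] by simp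

lemma L2_space_integrable: "X \<in> L2_space M \<Longrightarrow> integrable M (\<lambda>\<omega>. (X \<omega>)\<^sup>2)"
  by (simp add: L2_space_def)

lemma L2_space_cong: "(\<And>\<omega>. \<omega> \<in> space M \<Longrightarrow> X \<omega> = Y \<omega>) \<Longrightarrow> X \<in> L2_space M \<longleftrightarrow> Y \<in> L2_space M"
  unfolding L2_space_def mem_Collect_eq
  by (intro conj_cong measurable_cong Bochner_Integration.integrable_cong) auto

lemma L2_triangle:
  assumes "X \<in> L2_space M" "Y \<in> L2_space M" "Z \<in> L2_space M"
  shows "(\<integral>\<omega>. (X \<omega> - Z \<omega>)\<^sup>2 \<partial>M) \<le> 2 * (\<integral>\<omega>. (X \<omega> - Y \<omega>)\<^sup>2 \<partial>M) + 2 * (\<integral>\<omega>. (Y \<omega> - Z \<omega>)\<^sup>2 \<partial>M)"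
proof -
  note i = L2_space_integrable[OF L2_space_diff[OF assms(1,2)]] L2_space_integrable[OF L2_space_diff[OF assms(2,3)]]
    L2_space_integrable[OF L2_space_diff[OF assms(1,3)]]
  have "(\<integral>\<omega>. (X \<omega> - Z \<omega>)\<^sup>2 \<partial>M) \<le> (\<integral>\<omega>. 2 * (X \<omega> - Y \<omega>)\<^sup>2 + 2 * (Y \<omega> - Z \<omega>)\<^sup>2 \<partial>M)"
  proof (rule integral_mono)
    show "(X \<omega> - Z \<omega>)\<^sup>2 \<le> 2 * (X \<omega> - Y \<omega>)\<^sup>2 + 2 * (Y \<omega> - Z \<omega>)\<^sup>2" for \<omega>
      using square_add_le[of "X \<omega> - Y \<omega>" "Y \<omega> - Z \<omega>"] by simp
  qed (use i in auto)
  also have "\<dots> = 2 * (\<integral>\<omega>. (X \<omega> - Y \<omega>)\<^sup>2 \<partial>M) + 2 * (\<integral>\<omega>. (Y \<omega> - Z \<omega>)\<^sup>2 \<partial>M)"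
    using i by simp
  finally show ?thesis .
qed

text \<open>The Riesz-Fischer argument: along a fast subsequence the absolute increments have
  summable expectations, so it converges almost surely, and Fatou's lemma identifies the pointwise
  limit as the mean square limit.\<close>

lemma L2_complete:
  assumes "prob_space M" and Y: "\<And>n. Y n \<in> L2_space M"
    and Cauchy: "\<And>e. e > 0 \<Longrightarrow> \<exists>N. \<forall>m\<ge>N. \<forall>n\<ge>N. (\<integral>\<omega>. (Y m \<omega> - Y n \<omega>)\<^sup>2 \<partial>M) \<le> e"
  shows "\<exists>X. L2_tendsto M Y X"
proof -
  interpret prob_space M by fact
  have [measurable]: "Y n \<in> borel_measurable M" for n
    using Y by (auto simp: L2_space_def)
  note int = L2_space_integrable[OF L2_space_diff[OF Y Y]]
  have "\<exists>N. \<forall>k. \<forall>m\<ge>N k. \<forall>n\<ge>N k. (\<integral>\<omega>. (Y m \<omega> - Y n \<omega>)\<^sup>2 \<partial>M) \<le> (1 / 4) ^ k"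
    using Cauchy by (intro choice) auto
  then obtain N where N: "\<And>k m n. m \<ge> N k \<Longrightarrow> n \<ge> N k \<Longrightarrow> (\<integral>\<omega>. (Y m \<omega> - Y n \<omega>)\<^sup>2 \<partial>M) \<le> (1 / 4) ^ k"
    by blast
  \<comment> \<open>Partial sums provide an index that dominates \<open>N 0\<close> up to
    \<open>N k\<close> simultaneously.\<close>
  define r where "r k = (\<Sum>i\<le>k. N i)" for k
  have r: "r k \<ge> N j" if "j \<le> k" for j k
    unfolding r_def using that by (intro member_le_sum) auto
  define D where "D k \<omega> = \<bar>Y (r (Suc k)) \<omega> - Y (r k) \<omega>\<bar>" for k \<omega>
  have [measurable]: "D k \<in> borel_measurable M" for k
    unfolding D_def by measurable
  have D_le: "(\<integral>\<^sup>+\<omega>. D k \<omega> \<partial>M) \<le> ennreal ((1 / 2) ^ k)" for k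
  proof -
    have int': "integrable M (\<lambda>\<omega>. (2 ^ k * (Y (r (Suc k)) \<omega> - Y (r k) \<omega>)\<^sup>2 + (1 / 2) ^ k) / 2)"
      using int by simp
    \<comment> \<open>AM-GM: \<open>D \<le> (2\<^sup>k D\<^sup>2 + 2\<^sup>-\<^sup>k) / 2\<close>\<close>
    have "D k \<omega> \<le> (2 ^ k * (Y (r (Suc k)) \<omega> - Y (r k) \<omega>)\<^sup>2 + (1 / 2) ^ k) / 2" for \<omega>
    proof -
      have "0 \<le> (2 ^ k * D k \<omega> - 1)\<^sup>2 / 2 ^ k" by simp
      also have "\<dots> = 2 ^ k * (D k \<omega>)\<^sup>2 + (1 / 2) ^ k - 2 * D k \<omega>"
        by (simp add: power2_eq_square field_simps)
      finally show ?thesis by (simp add: D_def)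
    qed
    then have "(\<integral>\<^sup>+\<omega>. D k \<omega> \<partial>M) \<le> (\<integral>\<^sup>+\<omega>. (2 ^ k * (Y (r (Suc k)) \<omega> - Y (r k) \<omega>)\<^sup>2 + (1 / 2) ^ k) / 2 \<partial>M)"
      by (intro nn_integral_mono ennreal_leI)
    also have "\<dots> = ennreal (\<integral>\<omega>. (2 ^ k * (Y (r (Suc k)) \<omega> - Y (r k) \<omega>)\<^sup>2 + (1 / 2) ^ k) / 2 \<partial>M)"
      by (rule nn_integral_eq_integral[OF int']) simp
    also have "(\<integral>\<omega>. (2 ^ k * (Y (r (Suc k)) \<omega> - Y (r k) \<omega>)\<^sup>2 + (1 / 2) ^ k) / 2 \<partial>M)
        = (2 ^ k * (\<integral>\<omega>. (Y (r (Suc k)) \<omega> - Y (r k) \<omega>)\<^sup>2 \<partial>M) + (1 / 2) ^ k) / 2"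
      using int by (simp add: prob_space)
    also have "\<dots> \<le> (2 ^ k * (1 / 4) ^ k + (1 / 2) ^ k) / 2"
      using N[of k "r (Suc k)" "r k"] r by (intro divide_right_mono add_right_mono mult_left_mono) auto
    also have "\<dots> = (1 / 2) ^ k"
      by (simp add: power_mult_distrib[symmetric])
    finally show ?thesis by (simp add: ennreal_leI)
  qed
  have "(\<integral>\<^sup>+\<omega>. (\<Sum>k. ennreal (D k \<omega>)) \<partial>M) = (\<Sum>k. \<integral>\<^sup>+\<omega>. D k \<omega> \<partial>M)"
    by (rule nn_integral_suminf) measurable
  also have "\<dots> \<le> (\<Sum>k. ennreal ((1 / 2) ^ k))"
    by (intro suminf_le D_le) auto
  also have "\<dots> < \<infinity>"
    by (subst suminf_ennreal2) (auto simp: summable_geometric)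
  finally have "AE \<omega> in M. (\<Sum>k. ennreal (D k \<omega>)) \<noteq> \<infinity>"
    by (intro nn_integral_PInf_AE) auto
  then have conv: "AE \<omega> in M. convergent (\<lambda>k. Y (r k) \<omega>)"
  proof eventually_elim
    case (elim \<omega>)
    then have "summable (\<lambda>k. D k \<omega>)"
      by (intro summable_suminf_not_top) (auto simp: D_def)
    then have "summable (\<lambda>k. Y (r (Suc k)) \<omega> - Y (r k) \<omega>)"
      unfolding D_def by (rule summable_rabs_cancel)
    then have "convergent (\<lambda>n. \<Sum>k<n. Y (r (Suc k)) \<omega> - Y (r k) \<omega>)"
      by (simp add: summable_iff_convergent)
    then have "convergent (\<lambda>n. Y (r n) \<omega> - Y (r 0) \<omega>)"
      by (subst (asm) sum_lessThan_telescope[where f = "\<lambda>k. Y (r k) \<omega>"])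
    from convergent_add[OF this convergent_const[of "Y (r 0) \<omega>"]] show ?case
      by simp
  qed
  \<comment> \<open>Where the subsequence diverges \<open>lim\<close> is unspecified, but this
    happens only on a null set.\<close>
  define X where "X \<omega> = lim (\<lambda>k. Y (r k) \<omega>)" for \<omega>
  have [measurable]: "X \<in> borel_measurable M"
    unfolding X_def by (rule borel_measurable_lim_metric) measurable
  \<comment> \<open>A bound on the distances to all late terms of the subsequence passes to the
    distance from \<open>X\<close>.\<close>
  have fatou: "(\<integral>\<^sup>+\<omega>. (Y n \<omega> - X \<omega>)\<^sup>2 \<partial>M) \<le> ennreal e"
    if e: "\<And>m. m \<ge> K \<Longrightarrow> (\<integral>\<omega>. (Y n \<omega> - Y (r m) \<omega>)\<^sup>2 \<partial>M) \<le> e" for n e K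
  proof -
    have "AE \<omega> in M. liminf (\<lambda>m. ennreal ((Y n \<omega> - Y (r m) \<omega>)\<^sup>2)) = ennreal ((Y n \<omega> - X \<omega>)\<^sup>2)"
      using conv
    proof eventually_elim
      case (elim \<omega>)
      then have "(\<lambda>m. Y (r m) \<omega>) \<longlonglongrightarrow> X \<omega>"
        by (simp add: X_def convergent_LIMSEQ_iff)
      then have "(\<lambda>m. ennreal ((Y n \<omega> - Y (r m) \<omega>)\<^sup>2)) \<longlonglongrightarrow> ennreal ((Y n \<omega> - X \<omega>)\<^sup>2)"
        by (intro tendsto_intros)
      then show ?case
        by (intro lim_imp_Liminf) auto
    qed
    then have "(\<integral>\<^sup>+\<omega>. (Y n \<omega> - X \<omega>)\<^sup>2 \<partial>M) = (\<integral>\<^sup>+\<omega>. liminf (\<lambda>m. ennreal ((Y n \<omega> - Y (r m) \<omega>)\<^sup>2)) \<partial>M)"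
      by (intro nn_integral_cong_AE) auto
    also have "\<dots> \<le> liminf (\<lambda>m. \<integral>\<^sup>+\<omega>. (Y n \<omega> - Y (r m) \<omega>)\<^sup>2 \<partial>M)"
      by (rule nn_integral_liminf) measurable
    also have "\<dots> \<le> limsup (\<lambda>m. \<integral>\<^sup>+\<omega>. (Y n \<omega> - Y (r m) \<omega>)\<^sup>2 \<partial>M)"
      by (rule Liminf_le_Limsup) simp
    also have "\<dots> \<le> ennreal e"
    proof (rule Limsup_bounded, rule eventually_sequentiallyI[of K])
      fix m assume "m \<ge> K"
      from e[OF this] show "(\<integral>\<^sup>+\<omega>. (Y n \<omega> - Y (r m) \<omega>)\<^sup>2 \<partial>M) \<le> ennreal e"
        by (subst nn_integral_eq_integral[OF int]) (auto intro: ennreal_leI)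
    qed
    finally show ?thesis .
  qed
  have int_X: "integrable M (\<lambda>\<omega>. (Y n \<omega> - X \<omega>)\<^sup>2) \<and> (\<integral>\<omega>. (Y n \<omega> - X \<omega>)\<^sup>2 \<partial>M) \<le> (1 / 4) ^ k"
    if "n \<ge> N k" for n k
  proof -
    have le: "(\<integral>\<^sup>+\<omega>. (Y n \<omega> - X \<omega>)\<^sup>2 \<partial>M) \<le> ennreal ((1 / 4) ^ k)"
      using that r by (intro fatou[of k] N) auto
    then have "integrable M (\<lambda>\<omega>. (Y n \<omega> - X \<omega>)\<^sup>2)"
      by (intro integrableI_bounded) (auto intro: le_less_trans)
    with le show ?thesis
      by (simp add: nn_integral_eq_integral)
  qed
  have "(\<lambda>\<omega>. Y (N 0) \<omega> - X \<omega>) \<in> L2_space M"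
    using int_X[of 0 "N 0"] by (simp add: L2_space_def)
  from L2_space_diff[OF Y[of "N 0"] this] have X: "X \<in> L2_space M"
    by simp
  have "(\<lambda>n. \<integral>\<omega>. (Y n \<omega> - X \<omega>)\<^sup>2 \<partial>M) \<longlonglongrightarrow> 0"
  proof (rule LIMSEQ_I)
    fix e :: real assume "e > 0"
    then obtain k where k: "(1 / 4) ^ k < e"
      using real_arch_pow_inv[of e "1 / 4"] by auto
    have "norm (\<integral>\<omega>. (Y n \<omega> - X \<omega>)\<^sup>2 \<partial>M) < e" if "n \<ge> N k" for n
      using int_X[OF that] k by simp
    then show "\<exists>N. \<forall>n\<ge>N. norm ((\<integral>\<omega>. (Y n \<omega> - X \<omega>)\<^sup>2 \<partial>M) - 0) < e"
      by auto
  qed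
  then show ?thesis
    using X Y by (auto simp: L2_tendsto_def)
qed

text \<open>This yields the independence of the limit from the bump function: \<open>Y\<close> and
  \<open>Z\<close> will be smoothings by two different ones.\<close>

lemma L2_tendsto_transfer:
  assumes X: "L2_tendsto M Y X" and Z: "\<And>n. Z n \<in> L2_space M"
    and near: "\<And>e. e > 0 \<Longrightarrow> \<exists>N. \<forall>m\<ge>N. \<forall>n\<ge>N. (\<integral>\<omega>. (Z m \<omega> - Y n \<omega>)\<^sup>2 \<partial>M) \<le> e"
  shows "L2_tendsto M Z X"
proof -
  have L2: "Y n \<in> L2_space M" "X \<in> L2_space M" for n
    using X by (auto simp: L2_tendsto_def)
  have "(\<lambda>n. \<integral>\<omega>. (Z n \<omega> - X \<omega>)\<^sup>2 \<partial>M) \<longlonglongrightarrow> 0"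
  proof (rule LIMSEQ_I)
    fix e :: real assume "e > 0"
    \<comment> \<open>\<open>L2_triangle\<close> doubles each of the two errors, and four fifths of
      \<open>e\<close> stay below \<open>e\<close>.\<close>
    then obtain N where N: "\<And>m n. m \<ge> N \<Longrightarrow> n \<ge> N \<Longrightarrow> (\<integral>\<omega>. (Z m \<omega> - Y n \<omega>)\<^sup>2 \<partial>M) \<le> e / 5"
      using near[of "e / 5"] by auto
    have "\<forall>\<^sub>F n in sequentially. (\<integral>\<omega>. (Y n \<omega> - X \<omega>)\<^sup>2 \<partial>M) < e / 5"
      using X \<open>e > 0\<close> by (intro order_tendstoD[of _ 0]) (auto simp: L2_tendsto_def)
    from eventually_happens'[OF sequentially_bot eventually_conj[OF eventually_ge_at_top this]]
    obtain n where n: "n \<ge> N" "(\<integral>\<omega>. (Y n \<omega> - X \<omega>)\<^sup>2 \<partial>M) < e / 5"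
      by blast
    have "norm (\<integral>\<omega>. (Z m \<omega> - X \<omega>)\<^sup>2 \<partial>M) < e" if "m \<ge> N" for m
    proof -
      have "(\<integral>\<omega>. (Z m \<omega> - X \<omega>)\<^sup>2 \<partial>M) \<ge> 0" by simp
      then show ?thesis
        using L2_triangle[OF Z[of m] L2(1)[of n] L2(2)] N[OF that n(1)] n(2) \<open>e > 0\<close>
        unfolding real_norm_def by linarith
    qed
    then show "\<exists>N. \<forall>n\<ge>N. norm ((\<integral>\<omega>. (Z n \<omega> - X \<omega>)\<^sup>2 \<partial>M) - 0) < e"
      by auto
  qed
  then show ?thesis
    using Z L2 by (auto simp: L2_tendsto_def)
qed

text \<open>Passing from \<open>X\<close> to \<open>Y n\<close> to \<open>Y' n\<close> to
  \<open>X'\<close> applies the doubled triangle inequality twice, which produces the factor 4.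
  Index 0 is excluded because \<open>rescale\<close> degenerates there.\<close>

lemma L2_tendsto_diff_le:
  assumes X: "L2_tendsto M Y X" "L2_tendsto M Y' X'"
    and le: "\<And>n. n > 0 \<Longrightarrow> (\<integral>\<omega>. (Y n \<omega> - Y' n \<omega>)\<^sup>2 \<partial>M) \<le> B + c n" and c: "c \<longlonglongrightarrow> 0"
  shows "(\<integral>\<omega>. (X \<omega> - X' \<omega>)\<^sup>2 \<partial>M) \<le> 4 * B"
proof -
  have L2: "Y n \<in> L2_space M" "X \<in> L2_space M" "Y' n \<in> L2_space M" "X' \<in> L2_space M" for n
    using X by (auto simp: L2_tendsto_def)
  let ?b = "\<lambda>n. 2 * (\<integral>\<omega>. (Y n \<omega> - X \<omega>)\<^sup>2 \<partial>M) + 4 * (B + c n) + 4 * (\<integral>\<omega>. (Y' n \<omega> - X' \<omega>)\<^sup>2 \<partial>M)"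
  have "?b \<longlonglongrightarrow> 2 * 0 + 4 * (B + 0) + 4 * 0"
    using X c by (intro tendsto_intros) (auto simp: L2_tendsto_def)
  moreover have "(\<integral>\<omega>. (X \<omega> - X' \<omega>)\<^sup>2 \<partial>M) \<le> ?b n" if "n > 0" for n
    using L2_triangle[OF L2(2) L2(1) L2(4), of n] L2_triangle[OF L2(1) L2(3) L2(4), of n n] le[OF that]
    by (simp add: power2_commute[of "X _"])
  ultimately show ?thesis
    by (intro LIMSEQ_le_const[of ?b]) (auto intro!: exI[of _ 1])
qed

lemma centered_gaussian_moments:
  assumes "prob_space M" "centered_gaussian M X"
  shows "integrable M (\<lambda>\<omega>. (X \<omega>)\<^sup>2)" "(\<integral>\<omega>. X \<omega> \<partial>M) = 0"
proof -
  interpret prob_space M by fact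
  have [measurable]: "X \<in> borel_measurable M"
    using assms by (simp add: centered_gaussian_def)
  consider "AE \<omega> in M. X \<omega> = 0" | \<sigma> where "\<sigma> > 0" "distributed M lborel X (normal_density 0 \<sigma>)"
    using assms by (auto simp: centered_gaussian_def)
  then have "integrable M (\<lambda>\<omega>. (X \<omega>)\<^sup>2) \<and> (\<integral>\<omega>. X \<omega> \<partial>M) = 0"
  proof cases
    case 1
    then have "integrable M (\<lambda>\<omega>. (X \<omega>)\<^sup>2) \<longleftrightarrow> integrable M (\<lambda>_. 0 :: real)"
      by (intro integrable_cong_AE) auto
    moreover have "(\<integral>\<omega>. X \<omega> \<partial>M) = 0"
      using 1 by (rule integral_eq_zero_AE)
    ultimately show ?thesis by simp
  next
    case 2
    have "integrable lborel (\<lambda>x. normal_density 0 \<sigma> x * x\<^sup>2)"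
      using integrable_normal_moment[OF 2(1), of 0 2] by simp
    then have "integrable M (\<lambda>\<omega>. (X \<omega>)\<^sup>2)"
      by (subst distributed_integrable[OF 2(2), symmetric]) auto
    then show ?thesis
      using normal_distributed_expectation[OF 2] by simp
  qed
  then show "integrable M (\<lambda>\<omega>. (X \<omega>)\<^sup>2)" "(\<integral>\<omega>. X \<omega> \<partial>M) = 0" by auto
qed

section \<open>Increments of the log-correlated field\<close>

lemma convolve_mollifier_test_fun:
  assumes "prob_space \<mu>" "sets \<mu> = sets borel" "AE y in \<mu>. norm y \<le> R" "mollifier d \<phi>"
  shows "convolve \<mu> \<phi> \<in> test_fun (d + R)"
  using assms by (intro test_fun_convolve) (auto simp: mollifier_def)

text \<open>Both smoothed measures have integral 1, so their difference lies in the space on which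
  the law of the field is prescribed.\<close>

lemma convolve_diff_schwartz0:
  fixes \<mu> \<nu> :: "'a::euclidean_space measure"
  assumes \<mu>: "prob_space \<mu>" "sets \<mu> = sets borel" "AE y in \<mu>. norm y \<le> R" "mollifier d \<phi>"
    and \<nu>: "prob_space \<nu>" "sets \<nu> = sets borel" "AE y in \<nu>. norm y \<le> R'" "mollifier e \<phi>'"
  shows "(\<lambda>x. convolve \<mu> \<phi> x - convolve \<nu> \<phi>' x) \<in> schwartz0"
proof -
  note t = convolve_mollifier_test_fun[OF \<mu>] convolve_mollifier_test_fun[OF \<nu>]
  have "(\<lambda>x. convolve \<mu> \<phi> x - convolve \<nu> \<phi>' x) \<in> test_fun (max (d + R) (e + R'))"
    using t test_fun_mono[of "d + R" "max (d + R) (e + R')"] test_fun_mono[of "e + R'" "max (d + R) (e + R')"]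
    by (intro test_fun_diff) auto
  moreover have "(\<integral>x. convolve \<mu> \<phi> x - convolve \<nu> \<phi>' x \<partial>lborel) = 0"
    using t integral_convolve[OF \<mu>] integral_convolve[OF \<nu>] by (simp add: test_fun_integrable)
  ultimately show ?thesis
    using test_fun_subset_schwartz by (auto simp: schwartz0_def)
qed

context
  fixes M :: "'w measure" and h :: "'w \<Rightarrow> ('a::euclidean_space \<Rightarrow> real) \<Rightarrow> real"
  assumes field: "log_correlated_field_mod_const M h"
begin

interpretation prob_space M
  using field by (simp add: log_correlated_field_mod_const_def)

lemma field_linear:
  assumes "\<omega> \<in> space M" "f \<in> schwartz" "g \<in> schwartz"
  shows "h \<omega> (\<lambda>x. a * f x + b * g x) = a * h \<omega> f + b * h \<omega> g"
  using field assms
  by (simp add: log_correlated_field_mod_const_def random_tempered_distribution_def tempered_distribution_def)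

lemma field_diff:
  assumes "\<omega> \<in> space M" "f \<in> schwartz" "g \<in> schwartz"
  shows "h \<omega> (\<lambda>x. f x - g x) = h \<omega> f - h \<omega> g"
  using field_linear[OF assms, of 1 "- 1"] by simp

lemma
  assumes f: "f \<in> schwartz0"
  shows field_L2_space: "(\<lambda>\<omega>. h \<omega> f) \<in> L2_space M"
    and field_second_moment: "(\<integral>\<omega>. (h \<omega> f)\<^sup>2 \<partial>M)
      = (\<integral>(x, y). ln (1 / norm (x - y)) * f x * f y \<partial>(lborel \<Otimes>\<^sub>M lborel))"
proof -
  have G: "centered_gaussian M (\<lambda>\<omega>. h \<omega> f)"
    using field f by (simp add: log_correlated_field_mod_const_def)
  note moments = centered_gaussian_moments[OF prob_space_axioms G]
  show "(\<lambda>\<omega>. h \<omega> f) \<in> L2_space M"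
    using G moments by (simp add: L2_space_def centered_gaussian_def)
  have "(\<integral>\<omega>. (h \<omega> f)\<^sup>2 \<partial>M) = covariance M (\<lambda>\<omega>. h \<omega> f) (\<lambda>\<omega>. h \<omega> f)"
    by (simp add: covariance_def moments power2_eq_square)
  also have "\<dots> = (\<integral>(x, y). ln (1 / norm (x - y)) * f x * f y \<partial>(lborel \<Otimes>\<^sub>M lborel))"
    using field f by (simp add: log_correlated_field_mod_const_def)
  finally show "(\<integral>\<omega>. (h \<omega> f)\<^sup>2 \<partial>M)
      = (\<integral>(x, y). ln (1 / norm (x - y)) * f x * f y \<partial>(lborel \<Otimes>\<^sub>M lborel))" .
qed

text \<open>By linearity the increment is one pairing with a function of integral zero, whose
  variance is a combination of four energies. Undoing the smoothing in each costs one of the four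
  errors gathered in the last term.\<close>

lemma field_increment_le:
  assumes \<mu>: "spread p S R \<mu>" "mollifier d \<phi>" and \<nu>: "spread p S R' \<nu>" "mollifier e \<phi>'"
    and S: "S \<ge> 0" and p: "0 < p" "p \<le> 1" and de: "d \<ge> 0" "e \<ge> 0"
  shows "(\<integral>\<omega>. (h \<omega> (convolve \<mu> \<phi>) - h \<omega> (convolve \<nu> \<phi>'))\<^sup>2 \<partial>M)
    \<le> (log_energy \<mu> \<mu> - log_energy \<mu> \<nu> - log_energy \<nu> \<mu> + log_energy \<nu> \<nu>)
      + 4 * S * (2 * (d + e)) powr p / p"
proof -
  let ?f = "convolve \<mu> \<phi>" and ?g = "convolve \<nu> \<phi>'"
  have \<mu>': "prob_space \<mu>" "sets \<mu> = sets borel" "AE y in \<mu>. norm y \<le> R"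
    and \<nu>': "prob_space \<nu>" "sets \<nu> = sets borel" "AE y in \<nu>. norm y \<le> R'"
    using \<mu> \<nu> by (auto simp: spread_def)
  note t = convolve_mollifier_test_fun[OF \<mu>' \<mu>(2)] convolve_mollifier_test_fun[OF \<nu>' \<nu>(2)]
  have s: "?f \<in> schwartz" "?g \<in> schwartz"
    using t test_fun_subset_schwartz by blast+
  have m: "?f \<in> borel_measurable borel" "?g \<in> borel_measurable borel"
    using t by (auto intro!: borel_measurable_continuous_onI test_fun_continuous)
  have "(\<integral>\<omega>. (h \<omega> ?f - h \<omega> ?g)\<^sup>2 \<partial>M) = (\<integral>\<omega>. (h \<omega> (\<lambda>x. ?f x - ?g x))\<^sup>2 \<partial>M)"
    using field_diff[OF _ s] by (intro Bochner_Integration.integral_cong) auto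
  also have "\<dots> = (\<integral>(x, y). ln (1 / norm (x - y)) * (?f x - ?g x) * (?f y - ?g y) \<partial>(lborel \<Otimes>\<^sub>M lborel))"
    by (rule field_second_moment[OF convolve_diff_schwartz0[OF \<mu>' \<mu>(2) \<nu>' \<nu>(2)]])
  also have "\<dots> = log_energy (density lborel ?f) (density lborel ?f) - log_energy (density lborel ?f) (density lborel ?g)
      - log_energy (density lborel ?g) (density lborel ?f) + log_energy (density lborel ?g) (density lborel ?g)"
    using \<mu>(2) \<nu>(2)
    by (intro log_energy_density_diff[OF spread_convolve[OF \<mu>] spread_convolve[OF \<nu>] m _ _ p(1)] convolve_nonneg)
       (auto simp: mollifier_def)
  also have "\<dots> \<le> (log_energy \<mu> \<mu> - log_energy \<mu> \<nu> - log_energy \<nu> \<mu> + log_energy \<nu> \<nu>)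
      + (S * (d + d) powr p / p + S * (d + e) powr p / p + S * (e + d) powr p / p + S * (e + e) powr p / p)"
    using log_energy_convolve[OF \<mu>(1) \<mu>(1) \<mu>(2) \<mu>(2) S p] log_energy_convolve[OF \<mu>(1) \<nu>(1) \<mu>(2) \<nu>(2) S p]
      log_energy_convolve[OF \<nu>(1) \<mu>(1) \<nu>(2) \<mu>(2) S p] log_energy_convolve[OF \<nu>(1) \<nu>(1) \<nu>(2) \<nu>(2) S p]
    by linarith
  \<comment> \<open>All four sums of radii are at most \<open>2 * (d + e)\<close>.\<close>
  also have "S * (d + d) powr p / p + S * (d + e) powr p / p + S * (e + d) powr p / p + S * (e + e) powr p / p
      \<le> 4 * S * (2 * (d + e)) powr p / p"
  proof -
    have "S * t powr p / p \<le> S * (2 * (d + e)) powr p / p" if "0 \<le> t" "t \<le> 2 * (d + e)" for t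
      using that S p by (intro divide_right_mono mult_left_mono powr_mono2) auto
    from this[of "d + d"] this[of "d + e"] this[of "e + d"] this[of "e + e"] show ?thesis
      using de by simp
  qed
  finally show ?thesis by simp
qed

end

section \<open>Smoothing errors and existence of the pairing\<close>

lemma smoothing_error_tendsto_0:
  assumes "p > 0"
  shows "(\<lambda>n. 4 * S * (2 * (1 / real n + 1 / real n)) powr p / p) \<longlonglongrightarrow> 0"
proof -
  have "(\<lambda>n. 2 * (1 / real n + 1 / real n)) \<longlonglongrightarrow> 2 * (0 + 0)"
    by (intro tendsto_intros lim_1_over_n)
  then have "(\<lambda>n. (2 * (1 / real n + 1 / real n)) powr p) \<longlonglongrightarrow> 0"
    using assms by (intro tendsto_zero_powrI[where b = p]) auto
  then have "(\<lambda>n. 4 * S * (2 * (1 / real n + 1 / real n)) powr p / p) \<longlonglongrightarrow> 4 * S * 0 / p"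
    using assms by (intro tendsto_intros) auto
  then show ?thesis by simp
qed

lemma smoothing_error_small:
  assumes "p > 0" "S \<ge> 0" "e > 0"
  obtains N where "N > 0" "\<And>m n. m \<ge> N \<Longrightarrow> n \<ge> N \<Longrightarrow> 4 * S * (2 * (1 / real m + 1 / real n)) powr p / p \<le> e"
proof -
  have "\<forall>\<^sub>F n in sequentially. 4 * S * (2 * (1 / real n + 1 / real n)) powr p / p < e"
    by (rule order_tendstoD(2)[OF smoothing_error_tendsto_0[OF assms(1)] assms(3)])
  from eventually_happens'[OF sequentially_bot eventually_conj[OF eventually_gt_at_top this]]
  obtain N where N: "N > 0" "4 * S * (2 * (1 / real N + 1 / real N)) powr p / p < e"
    by blast
  have "4 * S * (2 * (1 / real m + 1 / real n)) powr p / p \<le> e" if "m \<ge> N" "n \<ge> N" for m n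
  proof -
    have "4 * S * (2 * (1 / real m + 1 / real n)) powr p / p \<le> 4 * S * (2 * (1 / real N + 1 / real N)) powr p / p"
      using that N(1) assms
      by (intro divide_right_mono mult_left_mono powr_mono2 add_mono divide_left_mono) auto
    then show ?thesis using N(2) by simp
  qed
  then show ?thesis using that N(1) by blast
qed

context
  fixes M :: "'w measure" and h :: "'w \<Rightarrow> ('a::euclidean_space \<Rightarrow> real) \<Rightarrow> real"
  assumes lcf: "log_correlated_field M h"
begin

lemma field_mod_const: "log_correlated_field_mod_const M h"
  using lcf by (simp add: log_correlated_field_def)

interpretation prob_space M
  using field_mod_const by (simp add: log_correlated_field_mod_const_def)

text \<open>A single function of integral 1 is not controlled by the covariance. The sphere
  normalization asserts mean square convergence, hence square integrability for the smoothed sphere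
  measure; subtracting that function leaves one of integral zero.\<close>

lemma field_convolve_L2_space:
  fixes \<mu> :: "'a measure"
  assumes \<mu>: "prob_space \<mu>" "sets \<mu> = sets borel" "AE y in \<mu>. norm y \<le> R" and \<psi>: "bump \<psi>"
  shows "(\<lambda>\<omega>. h \<omega> (convolve \<mu> (rescale \<psi> n))) \<in> L2_space M"
proof -
  let ?\<sigma> = "unit_sphere_measure :: 'a measure"
  let ?g = "convolve ?\<sigma> (rescale \<psi> 1)"
  note \<sigma> = unit_sphere_measure mollifier_rescale[OF \<psi>, of 1, OF zero_less_one]
  have g: "?g \<in> schwartz"
    using convolve_mollifier_test_fun[OF \<sigma>] test_fun_subset_schwartz by blast
  have hg: "(\<lambda>\<omega>. h \<omega> ?g) \<in> L2_space M"
    using lcf \<psi> by (auto simp: log_correlated_field_def has_pairing_def L2_tendsto_def)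
  show ?thesis
  proof (cases "n = 0")
    \<comment> \<open>At \<open>n = 0\<close> the prefactor \<open>0 ^ DIM('a)\<close> kills the
      mollifier, but \<open>L2_tendsto\<close> still requires square integrability at this
      index.\<close>
    case True
    then have "rescale \<psi> n = (\<lambda>x. 0)"
      by (simp add: rescale_def[abs_def] zero_power)
    then have "convolve \<mu> (rescale \<psi> n) = (\<lambda>x. 0)"
      by (simp add: convolve_def[abs_def])
    moreover have "h \<omega> (\<lambda>x. 0) = 0" if "\<omega> \<in> space M" for \<omega>
      using field_linear[OF field_mod_const that g g, of 0 0] by simp
    ultimately have "(\<lambda>\<omega>. h \<omega> (convolve \<mu> (rescale \<psi> n))) \<in> L2_space M \<longleftrightarrow> (\<lambda>\<omega>. 0) \<in> L2_space M"
      by (intro L2_space_cong) simp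
    then show ?thesis
      by (simp add: L2_space_def)
  next
    case False
    let ?f = "convolve \<mu> (rescale \<psi> n)"
    note m = mollifier_rescale[OF \<psi>, of n, OF False[unfolded neq0_conv]]
    have f: "?f \<in> schwartz"
      using convolve_mollifier_test_fun[OF \<mu> m] test_fun_subset_schwartz by blast
    have "(\<lambda>\<omega>. h \<omega> (\<lambda>x. ?f x - ?g x)) \<in> L2_space M"
      by (rule field_L2_space[OF field_mod_const convolve_diff_schwartz0[OF \<mu> m \<sigma>]])
    from L2_space_add[OF this hg] show ?thesis
      by (rule L2_space_cong[THEN iffD1, rotated]) (simp add: field_diff[OF field_mod_const _ f g] del: One_nat_def)
  qed
qed

lemma pairing_exists:
  fixes \<mu> :: "'a measure"
  assumes \<mu>: "spread p S R \<mu>" and S: "S \<ge> 0" and p: "0 < p" "p \<le> 1"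
  shows "\<exists>X. has_pairing M h \<mu> X"
proof -
  let ?Y = "\<lambda>\<psi> n \<omega>. h \<omega> (convolve \<mu> (rescale \<psi> n))"
  have L2: "?Y \<psi> n \<in> L2_space M" if "bump \<psi>" for \<psi> n
    using \<mu> that by (intro field_convolve_L2_space) (auto simp: spread_def)
  \<comment> \<open>Both measures equal \<open>\<mu>\<close>, so the energies cancel and only the
    smoothing error remains. Equal bump functions give the Cauchy property, different ones the
    independence of the choice.\<close>
  have small: "\<exists>N. \<forall>m\<ge>N. \<forall>n\<ge>N. (\<integral>\<omega>. (?Y \<psi> m \<omega> - ?Y \<psi>' n \<omega>)\<^sup>2 \<partial>M) \<le> e"
    if "bump \<psi>" "bump \<psi>'" "e > 0" for \<psi> \<psi>' e
  proof -
    obtain N where N: "N > 0" "\<And>m n. m \<ge> N \<Longrightarrow> n \<ge> N \<Longrightarrow> 4 * S * (2 * (1 / real m + 1 / real n)) powr p / p \<le> e"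
      using smoothing_error_small[OF p(1) S \<open>e > 0\<close>] by blast
    have "(\<integral>\<omega>. (?Y \<psi> m \<omega> - ?Y \<psi>' n \<omega>)\<^sup>2 \<partial>M) \<le> e" if "m \<ge> N" "n \<ge> N" for m n
      using field_increment_le[OF field_mod_const \<mu> mollifier_rescale[OF \<open>bump \<psi>\<close>, of m] \<mu>
          mollifier_rescale[OF \<open>bump \<psi>'\<close>, of n] S p] N(1) N(2)[OF that] that
      by simp
    then show ?thesis by blast
  qed
  obtain \<psi>0 :: "'a \<Rightarrow> real" where \<psi>0: "bump \<psi>0"
    using bump_exists by blast
  obtain X where X: "L2_tendsto M (?Y \<psi>0) X"
    using L2_complete[OF prob_space_axioms L2[OF \<psi>0] small[OF \<psi>0 \<psi>0]] by blast
  have "L2_tendsto M (?Y \<psi>) X" if "bump \<psi>" for \<psi>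
    by (rule L2_tendsto_transfer[OF X L2[OF that] small[OF that \<psi>0]])
  then show ?thesis
    by (auto simp: has_pairing_def)
qed

text \<open>Existence ensures that the chosen versions are genuine limits; following both along one
  bump function makes the smoothing error vanish and leaves the factor 4 of
  \<open>L2_tendsto_diff_le\<close>.\<close>

lemma pairing_increment_le:
  fixes \<mu> \<nu> :: "'a measure"
  assumes \<mu>: "spread p S R \<mu>" and \<nu>: "spread p S R' \<nu>" and S: "S \<ge> 0" and p: "0 < p" "p \<le> 1"
  shows "(\<integral>\<omega>. (pairing M h \<mu> \<omega> - pairing M h \<nu> \<omega>)\<^sup>2 \<partial>M)
    \<le> 4 * (log_energy \<mu> \<mu> - log_energy \<mu> \<nu> - log_energy \<nu> \<mu> + log_energy \<nu> \<nu>)"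
proof -
  obtain \<psi> :: "'a \<Rightarrow> real" where \<psi>: "bump \<psi>"
    using bump_exists by blast
  have "has_pairing M h \<mu> (pairing M h \<mu>)" "has_pairing M h \<nu> (pairing M h \<nu>)"
    unfolding pairing_def by (rule someI_ex[OF pairing_exists[OF _ S p]], fact)+
  then have X: "L2_tendsto M (\<lambda>n \<omega>. h \<omega> (convolve \<mu> (rescale \<psi> n))) (pairing M h \<mu>)"
      "L2_tendsto M (\<lambda>n \<omega>. h \<omega> (convolve \<nu> (rescale \<psi> n))) (pairing M h \<nu>)"
    using \<psi> by (auto simp: has_pairing_def)
  show ?thesis
    by (rule L2_tendsto_diff_le[OF X _ smoothing_error_tendsto_0[OF p(1), of S]],
        rule field_increment_le[OF field_mod_const \<mu> mollifier_rescale[OF \<psi>] \<nu> mollifier_rescale[OF \<psi>] S p]) auto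
qed

end

text \<open>By second countability the complement of the support is covered by countably many basic
  open null sets.\<close>

lemma AE_in_measure_support:
  fixes \<mu> :: "'a::euclidean_space measure"
  assumes sets: "sets \<mu> = sets borel"
  shows "AE x in \<mu>. x \<in> measure_support \<mu>"
proof -
  obtain B :: "'a set set" where B: "countable B" "topological_basis B"
    using ex_countable_basis by blast
  let ?N = "{U \<in> B. emeasure \<mu> U = 0}"
  have "\<Union>?N \<in> null_sets \<mu>"
  proof (rule null_sets_UN'[where N = "\<lambda>x. x" and I = "?N", simplified])
    show "countable ?N"
      using B(1) by (rule countable_subset[rotated]) auto
    show "U \<in> null_sets \<mu>" if "U \<in> B \<and> emeasure \<mu> U = 0" for U
      using that topological_basis_open[OF B(2)] by (auto simp: null_sets_def sets)
  qed
  then have "AE x in \<mu>. x \<notin> \<Union>?N"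
    by (rule AE_not_in)
  then show ?thesis
  proof eventually_elim
    case (elim x)
    show ?case
      unfolding measure_support_def
    proof (intro CollectI allI impI, rule ccontr)
      fix U assume U: "open U" "x \<in> U" "\<not> 0 < emeasure \<mu> U"
      obtain V where V: "V \<in> B" "x \<in> V" "V \<subseteq> U"
        using topological_basisE[OF B(2) U(1,2)] by blast
      have "emeasure \<mu> V \<le> emeasure \<mu> U"
        using V(3) U(1) by (intro emeasure_mono) (auto simp: sets)
      then show False
        using elim V U(3) by auto
    qed
  qed
qed

section \<open>Affine images of the mollifier\<close>

lemma riesz_bounded_mono: "riesz_bounded p S P X \<Longrightarrow> S \<le> S' \<Longrightarrow> riesz_bounded p S' P X"
  unfolding riesz_bounded_def by (meson ennreal_leI order_trans)

text \<open>The Riesz kernel is homogeneous of degree -p, and translations are absorbed by the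
  uniformity in the centre.\<close>

lemma
  fixes \<rho> :: "'a::euclidean_space measure"
  assumes "spread p S R \<rho>" "\<epsilon> > 0" "S \<ge> 0"
  shows riesz_bounded_affine: "riesz_bounded p (\<epsilon> powr (- p) * S) \<rho> (\<lambda>y. z + \<epsilon> *\<^sub>R y)"
    and bounded_rv_affine: "bounded_rv (norm z + \<epsilon> * R) \<rho> (\<lambda>y. z + \<epsilon> *\<^sub>R y)"
    and spread_affine: "spread p (\<epsilon> powr (- p) * S) (norm z + \<epsilon> * R) (distr \<rho> borel (\<lambda>y. z + \<epsilon> *\<^sub>R y))"
proof -
  have \<rho>: "prob_space \<rho>" "AE y in \<rho>. norm y \<le> R" "riesz_bounded p S \<rho> (\<lambda>y. y)"
    and sets [measurable_cong]: "sets \<rho> = sets borel"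
    using assms by (auto simp: spread_def)
  have [measurable]: "(\<lambda>y. riesz p (c - y)) \<in> borel_measurable \<rho>" "(\<lambda>y. z + \<epsilon> *\<^sub>R y) \<in> \<rho> \<rightarrow>\<^sub>M borel" for c
    unfolding measurable_cong_sets[OF sets refl] by measurable
  interpret prob_space \<rho> by fact
  show 1: "riesz_bounded p (\<epsilon> powr (- p) * S) \<rho> (\<lambda>y. z + \<epsilon> *\<^sub>R y)"
    unfolding riesz_bounded_def
  proof
    fix a
    have "a - (z + \<epsilon> *\<^sub>R y) = \<epsilon> *\<^sub>R ((a - z) /\<^sub>R \<epsilon> - y)" for y
      using \<open>\<epsilon> > 0\<close> by (simp add: algebra_simps)
    then have "(\<integral>\<^sup>+y. riesz p (a - (z + \<epsilon> *\<^sub>R y)) \<partial>\<rho>) = ennreal (\<epsilon> powr (- p)) * (\<integral>\<^sup>+y. riesz p ((a - z) /\<^sub>R \<epsilon> - y) \<partial>\<rho>)"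
      by (simp only: riesz_scaleR[OF \<open>\<epsilon> > 0\<close>]) (rule nn_integral_cmult, measurable)
    also have "\<dots> \<le> ennreal (\<epsilon> powr (- p)) * ennreal S"
      using \<rho>(3) by (intro mult_left_mono) (auto simp: riesz_bounded_def)
    finally show "(\<integral>\<^sup>+y. riesz p (a - (z + \<epsilon> *\<^sub>R y)) \<partial>\<rho>) \<le> ennreal (\<epsilon> powr (- p) * S)"
      using assms by (simp add: ennreal_mult)
  qed
  have "AE y in \<rho>. norm (z + \<epsilon> *\<^sub>R y) \<le> norm z + \<epsilon> * R"
    using \<rho>(2)
  proof eventually_elim
    case (elim y)
    then have "norm (\<epsilon> *\<^sub>R y) \<le> \<epsilon> * R"
      using \<open>\<epsilon> > 0\<close> by simp
    then show ?case
      using norm_triangle_ineq[of z "\<epsilon> *\<^sub>R y"] by linarith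
  qed
  then show 2: "bounded_rv (norm z + \<epsilon> * R) \<rho> (\<lambda>y. z + \<epsilon> *\<^sub>R y)"
    by (simp add: bounded_rv_def)
  show "spread p (\<epsilon> powr (- p) * S) (norm z + \<epsilon> * R) (distr \<rho> borel (\<lambda>y. z + \<epsilon> *\<^sub>R y))"
    using 1 2 by (auto simp: spread_def riesz_bounded_def bounded_rv_def nn_integral_distr AE_distr_iff
      intro!: prob_space_distr)
qed

text \<open>Both images are driven by the same \<open>y\<close>, so they are displaced by at most |z
  - w| + |\<epsilon> - r| R. The Riesz constant of the positive term scales like
  \<open>\<epsilon> powr (- p)\<close>, which turns d^p into (d / \<epsilon>)^p.\<close>

lemma log_energy_affine_diff_le:
  fixes \<rho> :: "'a::euclidean_space measure"
  assumes \<rho>: "spread p S R \<rho>" "R \<ge> 0" and S: "S \<ge> 0" and p: "0 < p" "p \<le> 1"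
    and pos: "\<epsilon> > 0" "r > 0" and d: "norm (z - w) + \<bar>\<epsilon> - r\<bar> * R \<le> d"
  defines "\<mu> \<equiv> distr \<rho> borel (\<lambda>y. z + \<epsilon> *\<^sub>R y)" and "\<nu> \<equiv> distr \<rho> borel (\<lambda>y. w + r *\<^sub>R y)"
  shows "log_energy \<mu> \<mu> - log_energy \<mu> \<nu> \<le> S * (d / \<epsilon>) powr p / p"
proof -
  let ?X = "\<lambda>y. z + \<epsilon> *\<^sub>R y" and ?Y = "\<lambda>y. w + r *\<^sub>R y"
  let ?R = "max (norm z + \<epsilon> * R) (norm w + r * R)"
  have "prob_space \<rho>"
    using \<rho> by (rule_tac spread_prob_space)
  have b: "bounded_rv ?R \<rho> ?X" "bounded_rv ?R \<rho> ?Y"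
    by (rule bounded_rv_mono[OF bounded_rv_affine[OF \<rho>(1) pos(1) S]]
        bounded_rv_mono[OF bounded_rv_affine[OF \<rho>(1) pos(2) S]]; simp)+
  note r = riesz_bounded_affine[OF \<rho>(1) pos(1) S, of z]
  have "AE y in \<rho>. norm y \<le> R"
    using \<rho> by (simp add: spread_def)
  then have near: "AE y in \<rho>. norm (?Y y - ?X y) \<le> d"
  proof eventually_elim
    case (elim y)
    have "?Y y - ?X y = - ((z - w) + (\<epsilon> - r) *\<^sub>R y)"
      by (simp add: algebra_simps)
    then have "norm (?Y y - ?X y) \<le> norm (z - w) + \<bar>\<epsilon> - r\<bar> * norm y"
      using norm_triangle_ineq[of "z - w" "(\<epsilon> - r) *\<^sub>R y"] by (simp only: norm_minus_cancel norm_scaleR)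
    also have "\<dots> \<le> norm (z - w) + \<bar>\<epsilon> - r\<bar> * R"
      using elim by (intro add_left_mono mult_left_mono) auto
    finally show ?case using d by simp
  qed
  \<comment> \<open>The first slot stays at \<open>\<mu>\<close>, hence displacement 0; only the
    second one moves.\<close>
  have "log_energy \<mu> \<mu> - log_energy \<mu> \<nu> \<le> (\<epsilon> powr (- p) * S) * (0 + d) powr p / p"
    unfolding \<mu>_def \<nu>_def using S near
    by (intro log_energy_diff_le[OF \<open>prob_space \<rho>\<close> \<open>prob_space \<rho>\<close> b(1) b(1) b(2) b(1) r r _ _ _ p]) auto
  also have "\<dots> = S * (d / \<epsilon>) powr p / p"
  proof -
    have "d \<ge> 0"
      using d \<rho>(2) by (metis abs_ge_zero add_nonneg_nonneg mult_nonneg_nonneg norm_ge_zero order_trans)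
    then show ?thesis
      using pos by (simp add: powr_divide powr_minus_divide)
  qed
  finally show ?thesis .
qed

text \<open>A centre outside the ball of radius \<open>R + e\<close> is at distance at least
  \<open>e\<close> from almost every point, where the kernel is at most \<open>e powr (- p)\<close>.
  The bound near the support thus becomes a bound at all centres.\<close>

lemma spread_of_local_bound:
  fixes \<rho> :: "'a::euclidean_space measure"
  assumes \<rho>: "prob_space \<rho>" "sets \<rho> = sets borel" "AE y in \<rho>. norm y \<le> R"
    and e: "e > 0" and p: "p > 0"
    and sup: "(SUP a\<in>ball 0 (R + e). \<integral>\<^sup>+y. 1 / ennreal (norm (a - y) powr p) \<partial>\<rho>) < \<infinity>"
  obtains S where "S \<ge> 0" "spread p S R \<rho>"
proof -
  interpret prob_space \<rho> by fact
  let ?T = "SUP a\<in>ball 0 (R + e). \<integral>\<^sup>+y. riesz p (a - y) \<partial>\<rho>"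
  define S where "S = max (enn2real ?T) (e powr (- p))"
  have T: "?T \<le> ennreal S"
    using sup unfolding S_def riesz_def[symmetric]
    by (metis ennreal_enn2real ennreal_leI infinity_ennreal_def max.cobounded1)
  have "riesz_bounded p S \<rho> (\<lambda>y. y)"
    unfolding riesz_bounded_def
  proof
    fix a :: 'a
    show "(\<integral>\<^sup>+y. riesz p (a - y) \<partial>\<rho>) \<le> ennreal S"
    proof (cases "a \<in> ball 0 (R + e)")
      case True
      then have "(\<integral>\<^sup>+y. riesz p (a - y) \<partial>\<rho>) \<le> ?T"
        by (rule SUP_upper)
      then show ?thesis using T by (rule order_trans)
    next
      case False
      have "AE y in \<rho>. riesz p (a - y) \<le> ennreal S"
        using \<rho>(3)
      proof eventually_elim
        case (elim y)
        then have "norm (a - y) \<ge> e"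
          using False norm_triangle_ineq2[of a y] by simp
        then have "riesz p (a - y) \<le> ennreal (e powr (- p))"
          using e p by (subst riesz_nonzero) (auto intro!: ennreal_leI powr_mono2')
        then show ?case
          by (rule order_trans) (simp add: S_def ennreal_leI)
      qed
      then have "(\<integral>\<^sup>+y. riesz p (a - y) \<partial>\<rho>) \<le> (\<integral>\<^sup>+y. ennreal S \<partial>\<rho>)"
        by (rule nn_integral_mono_AE)
      then show ?thesis
        by (simp add: emeasure_space_1)
    qed
  qed
  moreover have "S \<ge> 0"
    by (simp add: S_def le_max_iff_disj)
  ultimately show ?thesis
    using that \<rho> by (simp add: spread_def)
qed

theorem theorem1p8:
  fixes \<rho> :: "'a::euclidean_space measure" and p :: real
  assumes "DIM('a) \<ge> 2"
    and "0 < p" and "p \<le> 1"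
    and "admissible_mollifier \<rho>"
    and "\<exists>\<epsilon>\<^sub>0>0. (SUP a\<in>ball 0 (1 + \<epsilon>\<^sub>0). \<integral>\<^sup>+y. 1 / ennreal (norm (a - y) powr p) \<partial>\<rho>) < \<infinity>"
  shows "condition_A TYPE('w) p \<rho>"
proof -
  note p = assms(2,3)
  have sets: "sets \<rho> = sets borel"
    using assms(4) by (simp add: admissible_mollifier_def radon_measure_def)
  have "prob_space \<rho>"
    using assms(4) sets_eq_imp_space_eq[OF sets] by (intro prob_spaceI) (simp add: admissible_mollifier_def)
  moreover have "AE y in \<rho>. norm y \<le> 1"
    by (rule eventually_mono[OF AE_in_measure_support[OF sets]]) (use assms(4) in \<open>auto simp: admissible_mollifier_def\<close>)
  ultimately obtain S where S: "S \<ge> 0" and \<rho>: "spread p S 1 \<rho>"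
    using assms(5) spread_of_local_bound[OF _ sets _ _ p(1)] by metis
  \<comment> \<open>The constant combines 4 from \<open>pairing_increment_le\<close>, 2 from the two
    halves of the energy combination, \<open>2 powr p\<close> from the displacement bound
    \<open>d\<close>, and \<open>S / p\<close> from the Hoelder estimate.\<close>
  have bound: "(\<integral>\<omega>. (mollified_field M h \<rho> \<epsilon> z \<omega> - mollified_field M h \<rho> r w \<omega>)\<^sup>2 \<partial>M)
      \<le> (4 * (2 * (S * 2 powr p / p))) * (norm ((z, \<epsilon>) - (w, r)) / min \<epsilon> r) powr p"
    if h: "log_correlated_field M h" and pos: "0 < \<epsilon>" "0 < r"
    for M :: "'w measure" and h :: "'w \<Rightarrow> ('a \<Rightarrow> real) \<Rightarrow> real" and z w :: 'a and \<epsilon> r :: real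
  proof -
    let ?\<mu> = "distr \<rho> borel (\<lambda>y. z + \<epsilon> *\<^sub>R y)" and ?\<nu> = "distr \<rho> borel (\<lambda>y. w + r *\<^sub>R y)"
    let ?n = "norm ((z, \<epsilon>) - (w, r))" and ?m = "min \<epsilon> r"
    \<comment> \<open>\<open>pairing_increment_le\<close> asks for one Riesz constant for both
      images. Being absent from its conclusion, the maximum leaves no trace in the final
      constant.\<close>
    let ?S = "max (\<epsilon> powr (- p) * S) (r powr (- p) * S)"
    let ?B = "S * 2 powr p / p * (?n / ?m) powr p"
    have "norm (z - w) \<le> ?n" "\<bar>\<epsilon> - r\<bar> \<le> ?n"
      using norm_fst_le[of "z - w" "\<epsilon> - r"] norm_snd_le[of "\<epsilon> - r" "z - w"] by auto
    then have d: "norm (z - w) + \<bar>\<epsilon> - r\<bar> * 1 \<le> 2 * ?n" "norm (w - z) + \<bar>r - \<epsilon>\<bar> * 1 \<le> 2 * ?n"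
      by (auto simp: norm_minus_commute)
    have B: "S * (2 * ?n / s) powr p / p \<le> ?B" if "s \<ge> ?m" for s
    proof -
      have "(2 * ?n / s) powr p \<le> (2 * (?n / ?m)) powr p"
        using that pos p by (intro powr_mono2) (auto intro!: divide_left_mono)
      also have "\<dots> = 2 powr p * (?n / ?m) powr p"
        by (rule powr_mult)
      finally have "S / p * (2 * ?n / s) powr p \<le> S / p * (2 powr p * (?n / ?m) powr p)"
        using S p by (intro mult_left_mono) auto
      then show ?thesis by simp
    qed
    have \<mu>: "spread p ?S (norm z + \<epsilon> * 1) ?\<mu>" and \<nu>: "spread p ?S (norm w + r * 1) ?\<nu>"
      using spread_affine[OF \<rho> pos(1) S, of z] spread_affine[OF \<rho> pos(2) S, of w]
      by (auto simp: spread_def intro: riesz_bounded_mono)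
    have "(\<integral>\<omega>. (pairing M h ?\<mu> \<omega> - pairing M h ?\<nu> \<omega>)\<^sup>2 \<partial>M)
        \<le> 4 * (log_energy ?\<mu> ?\<mu> - log_energy ?\<mu> ?\<nu> - log_energy ?\<nu> ?\<mu> + log_energy ?\<nu> ?\<nu>)"
      using S by (intro pairing_increment_le[OF h \<mu> \<nu> _ p]) (simp add: le_max_iff_disj)
    also have "\<dots> \<le> 4 * (2 * ?B)"
      using log_energy_affine_diff_le[OF \<rho> _ S p pos d(1)] log_energy_affine_diff_le[OF \<rho> _ S p pos(2,1) d(2)]
        B[of \<epsilon>] B[of r] by simp
    finally show ?thesis
      by (simp add: mollified_field_def)
  qed
  show ?thesis
    unfolding condition_A_def by (intro exI allI impI ballI, rule bound) auto
qed

end
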